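(* Let $m>0$ and $e\in\mathbb{R}\setminus\{0\}$. Let $\mathbf{B}\colon\mathbb{R}^3\to\mathbb{R}^3$ be a vector field of the form $\mathbf{B}(q_1,q_2,q_3)=(0,0,B(q_1,q_2))$, where $B\in C^1(\mathbb{R}^2;\mathbb{R})$ is a radial function for which there are real numbers $A\neq0$, $A_1$, and $1<\gamma<\gamma_1$ such that (i) $B(u)=1+A|u|^{-\gamma}+A_1|u|^{-\gamma_1}+o(|u|^{-\gamma-1})$ as $|u|\to\infty$; (ii) $|\nabla B(u)|=O\big(|u|^{-\min\{\gamma+1,\gamma_1\}}\big)$ as $|u|\to\infty$. Then there exist positive constants $\overline\varepsilon,\mu,a_1,a_2$ such that for every $\varepsilon\in(0,\overline\varepsilon)$ if $A>0$, respectively for every $\varepsilon\in(-\overline\varepsilon,0)$ if $A<0$, there are $\rho_\varepsilon>0$ and a solution $u_\varepsilon\colon\mathbb{R}\to\mathbb{R}^2$ (of class $C^2$, with $\dot u_\varepsilon\ne0$ everywhere) of $\frac{i\dot u\cdot\ddot u}{|\dot u|^3}=B(u)$ on $\mathbb{R}$ such that: (a) $a_1|\varepsilon|^{-\frac1{\gamma+2}}\le\rho_\varepsilon\le a_2|\varepsilon|^{-\frac1{\gamma+2}}$ and $\|u_\varepsilon-v_{\varepsilon,\rho_\varepsilon}\|_{C^2}\le\mu|\varepsilon|^{\frac{\gamma}{\gamma+2}}$; (b) the curve parametrized by $u_\varepsilon$ is invariant with respect to rotations of angles $\frac{2\pi\varepsilon}{1-\varepsilon}$ and $\frac{2\pi}{1-\varepsilon}$,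 and is closed if $\varepsilon$ is rational; (c) there is a solution $q=(q_1,q_2,q_3)\colon\mathbb{R}\to\mathbb{R}^3$ of the Lorentz equation $m\ddot q=e\,\dot q\wedge\mathbf{B}(q)$ whose projection $(q_1,q_2)$ on the horizontal plane equals $u_\varepsilon$ up to a reparameterization in time, i.e. $(q_1,q_2)=u_\varepsilon\circ h$ for some diffeomorphism $h$ of $\mathbb{R}$ onto $\mathbb{R}$.
   Context: $\mathbb{R}^2$ is identified with $\mathbb{C}$; multiplication by $i$ is the counter-clockwise rotation by $\pi/2$, $\cdot$ is the Euclidean scalar product of $\mathbb{R}^2$, and $\wedge$ is the vector product in $\mathbb{R}^3$. For real $\varepsilon$ and $\rho>0$, $v_{\varepsilon,\rho}(t)=\rho e^{i\varepsilon t}+e^{it}$, $t\in\mathbb{R}$. The $C^2$ norm is the sum of the sup norms over $\mathbb{R}$ of the function and of its first two derivatives. "The curve parametrized by $u$" is understood as its image $u(\mathbb{R})$ for the rotational invariance; it is closed if $u$ is periodic. *)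

theory Defs
  imports "HOL-Analysis.Analysis" "HOL-Library.Landau_Symbols"
begin

definition gradient :: "('a::real_inner \<Rightarrow> real) \<Rightarrow> 'a \<Rightarrow> 'a" where
  "gradient f u = (THE g. GDERIV f u :> g)"

definition C1_scalar :: "('a::real_inner \<Rightarrow> real) \<Rightarrow> bool" where
  "C1_scalar f \<longleftrightarrow>
     (\<forall>u. \<exists>g. GDERIV f u :> g) \<and> continuous_on UNIV (gradient f)"

definition radial :: "('a::real_normed_vector \<Rightarrow> 'b) \<Rightarrow> bool" where
  "radial f \<longleftrightarrow> (\<forall>u v. norm u = norm v \<longrightarrow> f u = f v)"

definition vd :: "(real \<Rightarrow> 'a::real_normed_vector) \<Rightarrow> real \<Rightarrow> 'a" where
  "vd u t = vector_derivative u (at t)"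

definition C2_curve :: "(real \<Rightarrow> 'a::real_normed_vector) \<Rightarrow> bool" where
  "C2_curve u \<longleftrightarrow> u C1_differentiable_on UNIV \<and> vd u C1_differentiable_on UNIV"

(* Extended-real suprema, so that an unbounded function or derivative has norm \<infinity>;
   meaningful for u with C2_curve u. *)
definition C2_norm :: "(real \<Rightarrow> 'a::real_normed_vector) \<Rightarrow> ereal" where
  "C2_norm u = (SUP t. ereal (norm (u t))) + (SUP t. ereal (norm (vd u t)))
     + (SUP t. ereal (norm (vd (vd u) t)))"

definition ref_curve :: "real \<Rightarrow> real \<Rightarrow> real \<Rightarrow> complex" where
  "ref_curve \<epsilon> \<rho> t = of_real \<rho> * exp (\<i> * of_real (\<epsilon> * t)) + exp (\<i> * of_real t)"

definition curvature_solution :: "(complex \<Rightarrow> real) \<Rightarrow> (real \<Rightarrow> complex) \<Rightarrow> bool" where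
  "curvature_solution B u \<longleftrightarrow>
     C2_curve u \<and> (\<forall>t. vd u t \<noteq> 0) \<and>
     (\<forall>t. ((\<i> * vd u t) \<bullet> vd (vd u) t) / norm (vd u t) ^ 3 = B (u t))"

definition curve_rotation_invariant :: "real \<Rightarrow> (real \<Rightarrow> complex) \<Rightarrow> bool" where
  "curve_rotation_invariant \<theta> u \<longleftrightarrow> (\<lambda>z. exp (\<i> * of_real \<theta>) * z) ` range u = range u"

definition closed_curve :: "(real \<Rightarrow> 'a) \<Rightarrow> bool" where
  "closed_curve u \<longleftrightarrow> (\<exists>T>0. \<forall>t. u (t + T) = u t)"

definition lorentz_solution ::
    "real \<Rightarrow> real \<Rightarrow> (real ^ 3 \<Rightarrow> real ^ 3) \<Rightarrow> (real \<Rightarrow> real ^ 3) \<Rightarrow> bool" where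
  "lorentz_solution m e F q \<longleftrightarrow>
     C2_curve q \<and> (\<forall>t. m *\<^sub>R vd (vd q) t = e *\<^sub>R cross3 (vd q t) (F (q t)))"

definition real_diffeomorphism :: "(real \<Rightarrow> real) \<Rightarrow> bool" where
  "real_diffeomorphism h \<longleftrightarrow>
     bij h \<and> h C1_differentiable_on UNIV \<and> inv h C1_differentiable_on UNIV"

definition horizontal :: "real ^ 3 \<Rightarrow> complex" where
  "horizontal q = Complex (q $ 1) (q $ 2)"

end

theory Submission
  imports Defs
begin

text \<open>Where \<open>B > 0\<close>, a solution parametrized by its tangent angle satisfies the first order equation
  \<open>u' = \<i> exp (\<i> t) / B u\<close>. As \<open>B\<close> is radial, a solution that starts on the real axis and crosses the
  line at angle \<open>\<tau>\<close> normally is symmetric under the reflections at both lines, so that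
  \<open>u (t + 2 \<tau>) = exp (2 \<i> \<tau>) u t\<close>; the case \<open>\<tau> = \<pi> / (1 - \<epsilon>)\<close> is the wanted rotational symmetry.
  For the solution with \<open>u 0 = \<rho> + 1\<close>, expanding \<open>1 / B\<close> along \<open>\<rho> + exp (\<i> t)\<close> shows that
  \<open>Im (exp (- \<i> \<tau>) u \<tau>)\<close> is asymptotic to \<open>\<pi> (\<epsilon> \<rho> - (A \<gamma> / 2) \<rho> powr (- \<gamma> - 1))\<close>, which changes sign at
  \<open>\<epsilon> = (A \<gamma> / 2) \<rho> powr (- \<gamma> - 2)\<close>, so the intermediate value theorem in \<open>\<rho>\<close> yields \<open>\<rho>\<^sub>\<epsilon>\<close>. The
  \<open>C\<^sup>2\<close> estimate is read off the equation on one period.\<close>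

section \<open>Picard iteration on the real line\<close>

text \<open>The difficulty is one of precision: along the orbit \<open>1 / B\<close> differs from 1
  by order \<open>\<rho> powr (- \<gamma>)\<close>, but the drift to be balanced has the smaller
  order \<open>\<rho> powr (- \<gamma> - 1)\<close>. What helps is that the value of
  \<open>1 / B\<close> at distance \<rho> is constant along the orbit, and a constant factor only
  rescales the small circle, which still closes up. So only the variation of \<open>B\<close> over
  radial increments of bounded size matters; there the term with \<open>A\<close> dominates and
  varies like \<open>cos t\<close>. That mode is in resonance with the rotating tangent: the
  integral of the squared cosine over a half period is \<open>pi / 2\<close>, whence the factor 1/2
  in the balance. Against it stands the mismatch of angles,
  \<open>\<rho> * sin (pi / (1 - \<epsilon>))\<close>, close to
  \<open>- pi * \<epsilon> * \<rho>\<close>. The resulting relation between \<epsilon> and \<rho>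
  explains the exponent \<open>- 1 / (\<gamma> + 2)\<close>, and
  \<open>\<rho> powr (- \<gamma>)\<close>, the larger of the two errors in the norm estimate,
  becomes a multiple of \<open>\<bar>\<epsilon>\<bar> powr (\<gamma> / (\<gamma> + 2))\<close>. Near
  the origin \<open>B\<close> may vanish or be negative, so its reciprocal has to be cut off; the
  orbits stay so far out that they never notice.\<close>

lemma norm_increment_le:
  fixes f :: "real \<Rightarrow> 'a::real_normed_vector"
  assumes "a \<le> b"
    and "\<And>t. t \<in> {a..b} \<Longrightarrow> (f has_vector_derivative f' t) (at t)"
    and "\<And>t. t \<in> {a..b} \<Longrightarrow> norm (f' t) \<le> M"
  shows "norm (f b - f a) \<le> M * (b - a)"
proof -
  have "norm (f b - f a) \<le> M * norm (b - a)"
  proof (rule differentiable_bound[of "{a..b}" f "\<lambda>t x. x *\<^sub>R f' t"])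
    show "(f has_derivative (\<lambda>x. x *\<^sub>R f' t)) (at t within {a..b})" if "t \<in> {a..b}" for t
      using assms(2)[OF that] unfolding has_vector_derivative_def
      by (rule has_derivative_at_withinI)
    show "onorm (\<lambda>x. x *\<^sub>R f' t) \<le> M" if "t \<in> {a..b}" for t
      using assms(3)[OF that] by (intro onorm_le) (metis abs_ge_zero mult.commute mult_left_mono norm_scaleR real_norm_def)
  qed (use \<open>a \<le> b\<close> in auto)
  then show ?thesis using \<open>a \<le> b\<close> by simp
qed

lemma has_vector_derivative_compose_uminus:
  assumes "(f has_vector_derivative f') (at (- t))"
  shows "((\<lambda>s. f (- s)) has_vector_derivative - f') (at t)"
proof -
  have "((f \<circ> uminus) has_vector_derivative (- 1) *\<^sub>R f') (at t)"
    by (rule vector_diff_chain_at) (auto intro!: derivative_eq_intros assms)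
  then show ?thesis by (simp add: o_def)
qed

lemma norm_increment_abs_le:
  fixes f :: "real \<Rightarrow> 'a::real_normed_vector"
  assumes "\<And>t. (f has_vector_derivative f' t) (at t)" and "\<And>t. norm (f' t) \<le> M"
  shows "norm (f b - f a) \<le> M * \<bar>b - a\<bar>"
  using norm_increment_le[of a b f f' M] norm_increment_le[of b a f f' M] assms
  by (cases "a \<le> b") (auto simp: norm_minus_commute)

text \<open>Integrating an exponential gains the factor \<open>1 / K\<close>. This is what turns a
  Lipschitz operator into a contraction in a weighted norm; negative times follow by time
  reversal.\<close>

lemma norm_increment_exp_le:
  fixes f :: "real \<Rightarrow> 'a::real_normed_vector"
  assumes deriv: "\<And>t. (f has_vector_derivative f' t) (at t)"
    and bound: "\<And>t. norm (f' t) \<le> c * exp (K * \<bar>t\<bar>)" and "K > 0"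
  shows "norm (f t - f 0) \<le> c / K * (exp (K * \<bar>t\<bar>) - 1)"
proof -
  have *: "norm (h t - h 0) \<le> c / K * (exp (K * t) - 1)"
    if h: "\<And>s. (h has_vector_derivative h' s) (at s)"
      and h': "\<And>s. norm (h' s) \<le> c * exp (K * \<bar>s\<bar>)" and "t > 0"
    for h h' :: "real \<Rightarrow> 'a" and t
  proof -
    have "norm (h t - h 0) \<le> c / K * exp (K * t) - c / K * exp (K * 0)"
    proof (rule differentiable_bound_general[OF \<open>t > 0\<close>])
      show "continuous_on {0..t} h"
        using h has_vector_derivative_continuous by (intro continuous_at_imp_continuous_on) blast
      show "((\<lambda>s. c / K * exp (K * s)) has_vector_derivative c * exp (K * s)) (at s)" for s
        unfolding has_real_derivative_iff_has_vector_derivative[symmetric]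
        using \<open>K > 0\<close> by (auto intro!: derivative_eq_intros)
      show "norm (h' s) \<le> c * exp (K * s)" if "0 < s" for s
        using h'[of s] that by simp
      show "(h has_vector_derivative h' s) (at s)" for s by (rule h)
      show "continuous_on {0..t} (\<lambda>s. c / K * exp (K * s))"
        using \<open>K > 0\<close> by (intro continuous_intros) simp
    qed
    then show ?thesis by (simp add: algebra_simps)
  qed
  consider "t = 0" | "t > 0" | "t < 0" by linarith
  then show ?thesis
  proof cases
    case 2
    then show ?thesis using *[OF deriv bound] by simp
  next
    case 3
    have "norm (f (- (- t)) - f (- 0)) \<le> c / K * (exp (K * (- t)) - 1)"
    proof (rule *[of "\<lambda>s. f (- s)" "\<lambda>s. - f' (- s)"])
      show "((\<lambda>s. f (- s)) has_vector_derivative - f' (- s)) (at s)" for s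
        by (rule has_vector_derivative_compose_uminus[OF deriv])
      show "norm (- f' (- s)) \<le> c * exp (K * \<bar>s\<bar>)" for s using bound[of "- s"] by simp
    qed (use 3 in simp)
    then show ?thesis using 3 by simp
  qed simp
qed

section \<open>Antiderivatives on the whole line, with parameters\<close>

lemma antiderivative_exists:
  fixes f :: "real \<Rightarrow> 'a::banach"
  assumes "continuous_on UNIV f"
  obtains G where "\<And>t. (G has_vector_derivative f t) (at t)"
proof
  \<comment> \<open>One of the two intervals is always empty or a point, so this is the signed
    integral from 0 to \<open>t\<close> for either sign of \<open>t\<close>.\<close>
  define G where "G t = integral {0..t} f - integral {t..0} f" for t
  fix t :: real
  define N where "N = \<bar>t\<bar> + 1"
  have int: "f integrable_on {a..b}" for a b
    using assms by (meson continuous_on_subset integrable_continuous_real subset_UNIV)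
  have G: "G s = integral {-N..s} f - integral {-N..0} f" if "s \<in> {-N..N}" for s
  proof (cases "0 \<le> s")
    case True
    then have "integral {-N..0} f + integral {0..s} f = integral {-N..s} f"
      using that by (intro Henstock_Kurzweil_Integration.integral_combine int) (auto simp: N_def)
    moreover have "integral {s..0} f = 0"
      using True by (cases "s = 0") auto
    ultimately show ?thesis by (simp add: G_def algebra_simps)
  next
    case False
    then have "integral {-N..s} f + integral {s..0} f = integral {-N..0} f"
      using that by (intro Henstock_Kurzweil_Integration.integral_combine int) auto
    then show ?thesis using False by (simp add: G_def algebra_simps)
  qed
  have "((\<lambda>s. integral {-N..s} f - integral {-N..0} f) has_vector_derivative f t - 0)
      (at t within {-N..N})"
    by (intro has_vector_derivative_diff has_vector_derivative_const integral_has_vector_derivative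
        continuous_on_subset[OF assms]) (auto simp: N_def)
  moreover have "at t within {-N..N} = at t"
    by (rule at_within_interior) (auto simp: N_def)
  ultimately have "((\<lambda>s. integral {-N..s} f - integral {-N..0} f) has_vector_derivative f t) (at t)"
    by simp
  then show "(G has_vector_derivative f t) (at t)"
    by (rule has_vector_derivative_transform_within_open[where S = "{-N<..<N}"])
      (auto simp: N_def G)
qed

text \<open>The antiderivative vanishing at 0, rescaled to the fixed interval from 0 to 1: both
  signs of \<open>t\<close> are treated alike, and joint continuity in a parameter and
  \<open>t\<close> becomes continuity of a parametric integral over a fixed domain.\<close>

definition primitive :: "(real \<Rightarrow> 'a::banach) \<Rightarrow> real \<Rightarrow> 'a" where
  "primitive f t = t *\<^sub>R integral {0..1} (\<lambda>\<sigma>. f (\<sigma> * t))"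

lemma primitive_0 [simp]: "primitive f 0 = 0"
  by (simp add: primitive_def)

lemma primitive_has_vector_derivative:
  assumes "continuous_on UNIV f"
  shows "(primitive f has_vector_derivative f t) (at t)"
proof -
  obtain G where G: "\<And>t. (G has_vector_derivative f t) (at t)"
    using antiderivative_exists[OF assms] by blast
  have "primitive f t = G t - G 0" for t
  proof -
    have "((\<lambda>\<sigma>. t *\<^sub>R f (\<sigma> * t)) has_integral (G (1 * t) - G (0 * t))) {0..1}"
    proof (rule fundamental_theorem_of_calculus)
      fix \<sigma> :: real
      have "((G \<circ> (\<lambda>\<sigma>. \<sigma> * t)) has_vector_derivative t *\<^sub>R f (\<sigma> * t)) (at \<sigma>)"
        by (rule vector_diff_chain_at) (auto intro!: derivative_eq_intros G)
      then show "((\<lambda>\<sigma>. G (\<sigma> * t)) has_vector_derivative t *\<^sub>R f (\<sigma> * t)) (at \<sigma> within {0..1})"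
        by (simp add: o_def has_vector_derivative_at_within)
    qed simp
    then have "integral {0..1} (\<lambda>\<sigma>. t *\<^sub>R f (\<sigma> * t)) = G (1 * t) - G (0 * t)"
      by (rule integral_unique)
    then show ?thesis
      unfolding primitive_def integral_cmul mult_1 mult_zero_left .
  qed
  then have "primitive f = (\<lambda>t. G t - G 0)" by (simp add: fun_eq_iff)
  then show ?thesis
    using has_vector_derivative_diff[OF G[of t] has_vector_derivative_const[of "G 0" "at t"]] by simp
qed

lemma continuous_on_primitive_param:
  fixes f :: "'b::topological_space \<Rightarrow> real \<Rightarrow> 'a::banach"
  assumes "continuous_on UNIV (\<lambda>(x, t). f x t)"
  shows "continuous_on UNIV (\<lambda>(x, t). primitive (f x) t)"
proof -
  have "continuous_on (UNIV \<times> cbox 0 1) (\<lambda>(p, \<sigma>). f (fst p) (\<sigma> * snd p))"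
    unfolding case_prod_beta
    by (rule continuous_on_compose2[OF assms[unfolded case_prod_beta],
          of _ "\<lambda>x. (fst (fst x), snd x * snd (fst x))", unfolded fst_conv snd_conv])
      (auto intro!: continuous_intros)
  from integral_continuous_on_param[OF this]
  have "continuous_on UNIV (\<lambda>p. snd p *\<^sub>R integral {0..1} (\<lambda>\<sigma>. f (fst p) (\<sigma> * snd p)))"
    by (intro continuous_intros) simp
  then show ?thesis by (simp add: primitive_def case_prod_beta)
qed

text \<open>A bounded, globally Lipschitz field has solutions for all times. Continuity in the
  initial value is part of the conclusion because the final solution is selected by an intermediate
  value argument over starting points.\<close>

lemma ode_flow_exists:
  fixes f :: "real \<Rightarrow> 'a::banach \<Rightarrow> 'a"
  assumes cont: "continuous_on UNIV (\<lambda>(t, x). f t x)"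
    and bound: "\<And>t x. norm (f t x) \<le> M"
    and lip: "\<And>t x y. norm (f t x - f t y) \<le> L * norm (x - y)"
  obtains \<phi> where "\<And>x. \<phi> x 0 = x"
    and "\<And>x t. (\<phi> x has_vector_derivative f t (\<phi> x t)) (at t)"
    and "\<And>t. continuous_on UNIV (\<lambda>x. \<phi> x t)"
proof -
  \<comment> \<open>\<open>L\<close> carries no sign, whereas the weight needs a positive rate. The
    factor 2 in \<open>K\<close> makes the contraction constant 1/2.\<close>
  define L' where "L' = \<bar>L\<bar> + 1"
  define K where "K = 2 * L'"
  have "L' > 0" "K > 0" by (auto simp: L'_def K_def)
  have lip': "norm (f t x - f t y) \<le> L' * norm (x - y)" for t x y
    using lip[of t x y] by (rule order_trans) (auto simp: L'_def intro!: mult_right_mono)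
  have "M \<ge> 0" using bound[of 0 0] norm_ge_zero order_trans by blast
  \<comment> \<open>The weight \<open>exp (- K \<bar>t\<bar>)\<close> makes the Picard operator a contraction on the whole line; with the
    initial value as a second argument, its fixed point is the flow and is jointly continuous.\<close>
  define F where "F z x s = f s (x + exp (K * \<bar>s\<bar>) *\<^sub>R apply_bcontfun z (x, s))"
    for z :: "('a \<times> real) \<Rightarrow>\<^sub>C 'a" and x s
  define Q where "Q z = (\<lambda>(x, t). exp (- (K * \<bar>t\<bar>)) *\<^sub>R primitive (F z x) t)" for z
  have F_cont: "continuous_on UNIV (\<lambda>(x, s). F z x s)" for z
    unfolding F_def case_prod_beta
    by (rule continuous_on_compose2[OF cont[unfolded case_prod_beta],
          of _ "\<lambda>p. (snd p, fst p + exp (K * \<bar>snd p\<bar>) *\<^sub>R apply_bcontfun z (fst p, snd p))",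
          unfolded fst_conv snd_conv])
      (auto intro!: continuous_intros)
  have F_cont': "continuous_on UNIV (F z x)" for z x
    using continuous_on_compose2[OF F_cont[of z, unfolded case_prod_beta], of UNIV "\<lambda>s. (x, s)"]
    by (simp add: continuous_on_Pair)
  note P = primitive_has_vector_derivative[OF F_cont']
  \<comment> \<open>The unknown is the displacement from the initial value, since \<open>x\<close>
    itself is unbounded. A displacement is at most \<open>M * \<bar>t\<bar>\<close>, which the
    weight dominates.\<close>
  have Q_mem: "Q z \<in> bcontfun" for z
  proof (rule bcontfun_normI)
    show "continuous_on UNIV (Q z)"
      unfolding Q_def case_prod_beta
      by (intro continuous_intros continuous_on_primitive_param[OF F_cont, unfolded case_prod_beta])
    fix p :: "'a \<times> real"
    obtain x t where p: "p = (x, t)" by (cases p)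
    have "norm (primitive (F z x) t - primitive (F z x) 0) \<le> M * \<bar>t - 0\<bar>"
      by (rule norm_increment_abs_le[OF P]) (simp add: F_def bound)
    then have "norm (Q z p) \<le> exp (- (K * \<bar>t\<bar>)) * (M * \<bar>t\<bar>)"
      by (simp add: Q_def p)
    also have "\<dots> = M * \<bar>t\<bar> / exp (K * \<bar>t\<bar>)"
      by (simp add: exp_minus field_simps)
    also have "\<dots> \<le> M / K"
    proof -
      have "K * \<bar>t\<bar> \<le> exp (K * \<bar>t\<bar>)"
        using exp_ge_add_one_self[of "K * \<bar>t\<bar>"] by linarith
      from mult_left_mono[OF this \<open>M \<ge> 0\<close>] show ?thesis
        using \<open>K > 0\<close> by (simp add: field_simps)
    qed
    finally show "norm (Q z p) \<le> M / K" .
  qed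
  have Q_apply: "apply_bcontfun (Bcontfun (Q z)) = Q z" for z
    using Q_mem by (simp add: Bcontfun_inverse)
  have "\<exists>!z. Bcontfun (Q z) = z"
  proof (rule banach_fix_type[of "1 / 2"]; (intro allI)?)
    fix z z' :: "('a \<times> real) \<Rightarrow>\<^sub>C 'a"
    define d where "d = dist z z'"
    show "dist (Bcontfun (Q z)) (Bcontfun (Q z')) \<le> 1 / 2 * dist z z'"
    proof (rule dist_bound)
      fix p :: "'a \<times> real"
      obtain x t where p: "p = (x, t)" by (cases p)
      define D where "D t = primitive (F z x) t - primitive (F z' x) t" for t
      have "norm (D t - D 0) \<le> (L' * d) / K * (exp (K * \<bar>t\<bar>) - 1)"
      proof (rule norm_increment_exp_le[OF _ _ \<open>K > 0\<close>])
        show "(D has_vector_derivative F z x s - F z' x s) (at s)" for s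
          unfolding D_def by (intro has_vector_derivative_diff P)
        fix s
        have "norm (F z x s - F z' x s) \<le>
            L' * norm (exp (K * \<bar>s\<bar>) *\<^sub>R (apply_bcontfun z (x, s) - apply_bcontfun z' (x, s)))"
          unfolding F_def by (rule order_trans[OF lip']) (simp add: scaleR_diff_right)
        also have "\<dots> \<le> L' * (exp (K * \<bar>s\<bar>) * d)"
          using dist_bounded[of z "(x, s)" z'] \<open>L' > 0\<close>
          by (auto simp: dist_norm d_def intro!: mult_left_mono)
        finally show "norm (F z x s - F z' x s) \<le> L' * d * exp (K * \<bar>s\<bar>)"
          by (simp add: mult_ac)
      qed
      also have "\<dots> \<le> d / 2 * exp (K * \<bar>t\<bar>)"
        using \<open>L' > 0\<close> by (simp add: K_def d_def mult_left_mono field_simps)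
      finally have "exp (- (K * \<bar>t\<bar>)) * norm (D t) \<le> exp (- (K * \<bar>t\<bar>)) * (d / 2 * exp (K * \<bar>t\<bar>))"
        by (simp add: D_def)
      also have "\<dots> = d / 2" by (simp add: exp_minus field_simps)
      finally show "dist (apply_bcontfun (Bcontfun (Q z)) p) (apply_bcontfun (Bcontfun (Q z')) p)
          \<le> 1 / 2 * dist z z'"
        unfolding Q_apply by (simp add: Q_def p dist_norm D_def d_def scaleR_diff_right[symmetric])
    qed
  qed simp_all
  then obtain z where z: "Bcontfun (Q z) = z" by blast
  define \<phi> where "\<phi> x t = x + exp (K * \<bar>t\<bar>) *\<^sub>R apply_bcontfun z (x, t)" for x t
  have \<phi>: "\<phi> x = (\<lambda>t. x + primitive (F z x) t)" for x
  proof
    fix t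
    have "apply_bcontfun z (x, t) = Q z (x, t)" using Q_apply[of z] by (simp add: z)
    then show "\<phi> x t = x + primitive (F z x) t"
      by (simp add: \<phi>_def Q_def exp_minus)
  qed
  have F_\<phi>: "F z x t = f t (\<phi> x t)" for x t
    by (simp add: F_def \<phi>_def)
  show thesis
  proof
    show "\<phi> x 0 = x" for x by (simp add: \<phi>)
    show "(\<phi> x has_vector_derivative f t (\<phi> x t)) (at t)" for x t
      using has_vector_derivative_add[OF has_vector_derivative_const[of x] P[of z x t]]
      by (simp add: F_\<phi>[symmetric] \<phi>[symmetric])
    show "continuous_on UNIV (\<lambda>x. \<phi> x t)" for t
      unfolding \<phi>_def by (intro continuous_intros continuous_on_compose2[OF continuous_on_apply_bcontfun]) auto
  qed
qed

text \<open>Gronwall in energy form: the squared distance of two solutions, damped by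
  \<open>exp (- (2 * L * s))\<close>, cannot increase. Times before \<open>a\<close> are reached by
  time reversal.\<close>

lemma ode_unique:
  fixes f :: "real \<Rightarrow> 'a::real_inner \<Rightarrow> 'a"
  assumes lip: "\<And>t x y. norm (f t x - f t y) \<le> L * norm (x - y)"
    and u: "\<And>t. (u has_vector_derivative f t (u t)) (at t)"
    and v: "\<And>t. (v has_vector_derivative f t (v t)) (at t)"
    and "u a = v a"
  shows "u t = v t"
proof -
  have pos: "w b = 0"
    if "\<And>s. (w has_vector_derivative w' s) (at s)" "\<And>s. norm (w' s) \<le> L * norm (w s)"
      "w a = 0" "a \<le> b" for w w' :: "real \<Rightarrow> 'a" and a b
  proof -
    define p where "p s = (w s \<bullet> w s) * exp (- (2 * L * s))" for s
    have "p b \<le> p a"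
    proof (rule DERIV_nonpos_imp_nonincreasing[OF \<open>a \<le> b\<close>])
      fix s
      have d: "((\<lambda>s. w s \<bullet> w s) has_real_derivative 2 * (w s \<bullet> w' s)) (at s)"
        using has_derivative_inner[OF that(1)[unfolded has_vector_derivative_def]
            that(1)[unfolded has_vector_derivative_def], of s]
        unfolding has_field_derivative_def
        by (rule has_derivative_eq_rhs) (auto simp: fun_eq_iff inner_commute algebra_simps)
      have "(p has_real_derivative
          (2 * (w s \<bullet> w' s) - 2 * L * (w s \<bullet> w s)) * exp (- (2 * L * s))) (at s)"
        unfolding p_def by (rule derivative_eq_intros d refl | simp add: algebra_simps)+
      moreover have "w s \<bullet> w' s \<le> L * (w s \<bullet> w s)"
      proof -
        have "w s \<bullet> w' s \<le> norm (w s) * norm (w' s)" by (rule norm_cauchy_schwarz)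
        also have "\<dots> \<le> norm (w s) * (L * norm (w s))"
          by (intro mult_left_mono that(2)) auto
        also have "\<dots> = L * (w s \<bullet> w s)"
          by (simp add: power2_norm_eq_inner[symmetric] power2_eq_square)
        finally show ?thesis .
      qed
      ultimately show "\<exists>y. (p has_real_derivative y) (at s) \<and> y \<le> 0"
        by (intro exI conjI) (assumption, simp add: mult_le_0_iff)
    qed
    then have "w b \<bullet> w b \<le> 0"
      using \<open>w a = 0\<close> by (simp add: p_def mult_le_0_iff)
    then show "w b = 0"
      by (metis inner_ge_zero inner_eq_zero_iff order_antisym)
  qed
  define w w' where "w s = u s - v s" and "w' s = f s (u s) - f s (v s)" for s
  have w: "(w has_vector_derivative w' s) (at s)" "norm (w' s) \<le> L * norm (w s)" for s
    unfolding w_def w'_def by (auto intro!: has_vector_derivative_diff u v lip)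
  have "w t = 0"
  proof (cases "a \<le> t")
    case True
    then show ?thesis using pos[of w w' a t] w \<open>u a = v a\<close> by (simp add: w_def)
  next
    case False
    have "w (- (- t)) = 0"
    proof (rule pos[of "\<lambda>s. w (- s)" "\<lambda>s. - w' (- s)"])
      show "((\<lambda>s. w (- s)) has_vector_derivative - w' (- s)) (at s)" for s
        by (rule has_vector_derivative_compose_uminus[OF w(1)])
      show "norm (- w' (- s)) \<le> L * norm (w (- s))" for s
        using w(2)[of "- s"] by simp
      show "w (- (- a)) = 0" using \<open>u a = v a\<close> by (simp add: w_def)
    qed (use False in simp)
    then show ?thesis by simp
  qed
  then show ?thesis by (simp add: w_def)
qed

section \<open>Curves and gradients\<close>

lemma C1_differentiable_onI:
  assumes "\<And>t. (u has_vector_derivative u' t) (at t)" "continuous_on UNIV u'"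
  shows "u C1_differentiable_on UNIV"
  using assms unfolding C1_differentiable_on_def by blast

lemma vd_eqI:
  assumes "\<And>t. (u has_vector_derivative u' t) (at t)"
  shows "vd u = u'"
  using assms by (auto simp: vd_def fun_eq_iff vector_derivative_at)

lemma C2_curveI:
  assumes "\<And>t. (u has_vector_derivative u' t) (at t)"
    and "\<And>t. (u' has_vector_derivative u'' t) (at t)" and "continuous_on UNIV u''"
  shows "C2_curve u"
proof -
  have "continuous_on UNIV u'"
    using assms(2) has_vector_derivative_continuous by (intro continuous_at_imp_continuous_on) blast
  then show ?thesis
    unfolding C2_curve_def vd_eqI[OF assms(1)]
    using C1_differentiable_onI[of u u'] C1_differentiable_onI[of u' u''] assms by blast
qed

lemma C2_norm_leI:
  assumes "\<And>t. (u has_vector_derivative u' t) (at t)"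
    and "\<And>t. (u' has_vector_derivative u'' t) (at t)"
    and "\<And>t. norm (u t) \<le> a" "\<And>t. norm (u' t) \<le> b" "\<And>t. norm (u'' t) \<le> c"
  shows "C2_norm u \<le> ereal (a + b + c)"
proof -
  have "C2_norm u \<le> ereal a + ereal b + ereal c"
    unfolding C2_norm_def vd_eqI[OF assms(1)] vd_eqI[OF assms(2)]
    by (intro add_mono SUP_least) (auto simp: assms)
  then show ?thesis by simp
qed

text \<open>The definite description in \<open>gradient\<close> needs uniqueness: two candidates
  represent the same functional, so their difference is orthogonal to everything.\<close>

lemma GDERIV_gradient:
  assumes "C1_scalar f"
  shows "GDERIV f x :> gradient f x"
proof -
  obtain g where g: "GDERIV f x :> g"
    using assms by (auto simp: C1_scalar_def)
  have "h = g" if "GDERIV f x :> h" for h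
  proof -
    have "(\<lambda>y. y \<bullet> h) = (\<lambda>y. y \<bullet> g)"
      using has_derivative_unique that g unfolding gderiv_def by blast
    then show ?thesis
      by (metis inner_eq_zero_iff inner_diff_right eq_iff_diff_eq_0)
  qed
  then show ?thesis
    unfolding gradient_def using g by (metis the_equality)
qed

lemma C1_scalar_continuous_on:
  assumes "C1_scalar f"
  shows "continuous_on S f"
  using GDERIV_gradient[OF assms] has_derivative_continuous
  unfolding gderiv_def by (blast intro: continuous_at_imp_continuous_on)

lemma C1_scalar_compose_has_real_derivative:
  assumes "C1_scalar f" and "(u has_vector_derivative u') (at t)"
  shows "((\<lambda>t. f (u t)) has_real_derivative u' \<bullet> gradient f (u t)) (at t)"
  using has_derivative_compose[OF assms(2)[unfolded has_vector_derivative_def]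
      GDERIV_gradient[OF assms(1), unfolded gderiv_def]]
  by (simp add: has_field_derivative_def mult.commute[of _ "u' \<bullet> gradient f (u t)"])

lemma C1_scalar_lipschitz:
  fixes f :: "'a::euclidean_space \<Rightarrow> real"
  assumes "C1_scalar f" and "\<And>x. norm (gradient f x) \<le> L"
  shows "\<bar>f x - f y\<bar> \<le> L * norm (x - y)"
proof -
  have "norm (f x - f y) \<le> L * norm (x - y)"
  proof (rule differentiable_bound[of UNIV f "\<lambda>x h. h \<bullet> gradient f x"])
    show "onorm (\<lambda>h. h \<bullet> gradient f x) \<le> L" for x
    proof (rule onorm_le)
      fix h
      have "norm (h \<bullet> gradient f x) \<le> norm h * norm (gradient f x)"
        by (simp add: Cauchy_Schwarz_ineq2)
      also have "\<dots> \<le> L * norm h"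
        using mult_left_mono[OF assms(2)[of x], of "norm h"] by (simp add: mult.commute)
      finally show "norm (h \<bullet> gradient f x) \<le> L * norm h" .
    qed
  qed (use GDERIV_gradient[OF assms(1)] in \<open>auto simp: gderiv_def\<close>)
  then show ?thesis by simp
qed

text \<open>Decay controls only large arguments; the remaining ball is compact. Its radius is at
  least 1 so that a negative power of the norm is at most 1 outside.\<close>

lemma bounded_gradient:
  fixes f :: "'a::euclidean_space \<Rightarrow> real"
  assumes "C1_scalar f" and "(\<lambda>x. norm (gradient f x)) \<in> O[at_infinity](\<lambda>x. norm x powr (- p))" and "p \<ge> 0"
  obtains L where "\<And>x. norm (gradient f x) \<le> L"
proof -
  obtain c where "c > 0" and c: "\<forall>\<^sub>F x in at_infinity. norm (gradient f x) \<le> c * norm x powr (- p)"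
    using landau_o.bigE[OF assms(2)] by auto
  then obtain R where R: "\<And>x. norm x \<ge> R \<Longrightarrow> norm (gradient f x) \<le> c * norm x powr (- p)"
    by (auto simp: eventually_at_infinity)
  have "continuous_on (cball 0 (max R 1)) (\<lambda>x. norm (gradient f x))"
    using assms(1) by (intro continuous_on_norm) (auto simp: C1_scalar_def intro: continuous_on_subset)
  then have "bounded ((\<lambda>x. norm (gradient f x)) ` cball 0 (max R 1))"
    by (intro compact_imp_bounded compact_continuous_image) auto
  then obtain L where "\<forall>y\<in>(\<lambda>x. norm (gradient f x)) ` cball 0 (max R 1). norm y \<le> L"
    unfolding bounded_iff by blast
  then have L: "norm (gradient f x) \<le> L" if "norm x \<le> max R 1" for x
    using that by auto
  have "norm (gradient f x) \<le> max L c" for x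
  proof (cases "norm x \<le> max R 1")
    case True
    then show ?thesis using L by fastforce
  next
    case False
    then have "norm x powr (- p) \<le> norm x powr 0"
      using \<open>p \<ge> 0\<close> by (intro powr_mono) auto
    also have "\<dots> = 1" using False by auto
    finally have "c * norm x powr (- p) \<le> c"
      using \<open>c > 0\<close> by simp
    then show ?thesis using R[of x] False by linarith
  qed
  then show thesis by (rule that)
qed

section \<open>The tangent angle equation\<close>

text \<open>A curve of positive curvature \<open>1/g\<close> is parametrized here by its tangent angle (shifted by
  \<open>\<pi>/2\<close>), which turns the curvature equation into a first order equation.\<close>

definition angle_field :: "(complex \<Rightarrow> real) \<Rightarrow> real \<Rightarrow> complex \<Rightarrow> complex" where
  "angle_field g t z = g z *\<^sub>R (\<i> * cis t)"

definition angle_solution :: "(complex \<Rightarrow> real) \<Rightarrow> (real \<Rightarrow> complex) \<Rightarrow> bool" where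
  "angle_solution g u \<longleftrightarrow> (\<forall>t. (u has_vector_derivative angle_field g t (u t)) (at t))"

lemma radialD: "radial f \<Longrightarrow> norm u = norm v \<Longrightarrow> f u = f v"
  unfolding radial_def by blast

lemma norm_angle_field [simp]: "norm (angle_field g t z) = \<bar>g z\<bar>"
  by (simp add: angle_field_def norm_mult)

lemma angle_field_lipschitz:
  assumes "\<And>x y. \<bar>g x - g y\<bar> \<le> L * norm (x - y)"
  shows "norm (angle_field g t x - angle_field g t y) \<le> L * norm (x - y)"
proof -
  have "norm (angle_field g t x - angle_field g t y) = \<bar>g x - g y\<bar>"
    unfolding angle_field_def scaleR_diff_left[symmetric] by (simp add: norm_mult)
  then show ?thesis using assms by simp
qed

text \<open>\<open>cis (2 * \<tau>) * cnj z\<close> is the reflection of \<open>z\<close> at the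
  line of angle \<tau>; it keeps the norm and hence the value of \<open>g\<close>. The sign from
  reversing time cancels the sign from conjugating \<open>\<i>\<close>.\<close>

lemma angle_solution_reflect:
  assumes "angle_solution g u" and "radial g"
  shows "angle_solution g (\<lambda>t. cis (2 * \<tau>) * cnj (u (2 * \<tau> - t)))"
  unfolding angle_solution_def
proof
  fix t
  have "((u \<circ> (\<lambda>t. 2 * \<tau> - t)) has_vector_derivative (- 1) *\<^sub>R angle_field g (2 * \<tau> - t) (u (2 * \<tau> - t))) (at t)"
    using assms(1) unfolding angle_solution_def
    by (intro vector_diff_chain_at) (auto intro!: derivative_eq_intros)
  then have "((\<lambda>t. cnj (u (2 * \<tau> - t))) has_vector_derivative
      cnj (- angle_field g (2 * \<tau> - t) (u (2 * \<tau> - t)))) (at t)"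
    by (intro has_vector_derivative_cnj) (simp add: o_def)
  then have "((\<lambda>t. cis (2 * \<tau>) * cnj (u (2 * \<tau> - t))) has_vector_derivative
      cis (2 * \<tau>) * cnj (- angle_field g (2 * \<tau> - t) (u (2 * \<tau> - t)))) (at t)"
    by (rule has_vector_derivative_mult_right)
  moreover have "cis (2 * \<tau>) * cnj (- angle_field g (2 * \<tau> - t) (u (2 * \<tau> - t))) =
      angle_field g t (cis (2 * \<tau>) * cnj (u (2 * \<tau> - t)))"
  proof -
    have "g (cis (2 * \<tau>) * cnj (u (2 * \<tau> - t))) = g (u (2 * \<tau> - t))"
      by (rule radialD[OF \<open>radial g\<close>]) (simp add: norm_mult)
    moreover have "cis (2 * \<tau>) * cnj (cis (2 * \<tau> - t)) = cis t"
      unfolding cis_cnj cis_mult by simp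
    ultimately show ?thesis
      by (simp add: angle_field_def scaleR_conv_of_real mult_ac)
  qed
  ultimately show "((\<lambda>t. cis (2 * \<tau>) * cnj (u (2 * \<tau> - t))) has_vector_derivative
      angle_field g t (cis (2 * \<tau>) * cnj (u (2 * \<tau> - t)))) (at t)" by simp
qed

text \<open>A solution that crosses two lines through the origin along the normal direction is symmetric
  under the reflections at both lines, hence under their composition.\<close>

lemma angle_solution_rotation:
  assumes "angle_solution g u" and "radial g"
    and lip: "\<And>x y. \<bar>g x - g y\<bar> \<le> L * norm (x - y)"
    and "Im (u 0) = 0" and "Im (cis (- \<tau>) * u \<tau>) = 0"
  shows "u (t + 2 * \<tau>) = cis (2 * \<tau>) * u t"
proof -
  \<comment> \<open>At time \<sigma> the tangent already points along
    \<open>\<i> * cis \<sigma>\<close>, so a normal crossing only asks that the point lie on the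
    line of angle \<sigma>. It is then fixed by the reflection, and uniqueness identifies the
    solution with its mirror image.\<close>
  have refl: "u t = cis (2 * \<sigma>) * cnj (u (2 * \<sigma> - t))" if "Im (cis (- \<sigma>) * u \<sigma>) = 0" for \<sigma> t
  proof (rule ode_unique[where f = "angle_field g" and L = L and a = \<sigma>
        and v = "\<lambda>t. cis (2 * \<sigma>) * cnj (u (2 * \<sigma> - t))"])
    have "cnj (cis (- \<sigma>) * u \<sigma>) = cis (- \<sigma>) * u \<sigma>"
      using that by (intro complex_eqI) (simp_all del: cis.sel)
    then have "cis \<sigma> * cnj (u \<sigma>) = cis (- \<sigma>) * u \<sigma>"
      unfolding complex_cnj_mult cis_cnj minus_minus .
    then have "cis \<sigma> * cis \<sigma> * cnj (u \<sigma>) = cis \<sigma> * cis (- \<sigma>) * u \<sigma>"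
      by (metis mult.assoc)
    then have "cis (2 * \<sigma>) * cnj (u \<sigma>) = u \<sigma>"
      unfolding cis_mult mult_2 by simp
    then show "u \<sigma> = cis (2 * \<sigma>) * cnj (u (2 * \<sigma> - \<sigma>))" by simp
    show "(u has_vector_derivative angle_field g t (u t)) (at t)" for t
      using assms(1) by (simp add: angle_solution_def)
    show "((\<lambda>t. cis (2 * \<sigma>) * cnj (u (2 * \<sigma> - t))) has_vector_derivative
        angle_field g t (cis (2 * \<sigma>) * cnj (u (2 * \<sigma> - t)))) (at t)" for t
      using angle_solution_reflect[OF assms(1,2)] by (simp add: angle_solution_def)
  qed (rule angle_field_lipschitz[OF lip])
  have "u (t + 2 * \<tau>) = cis (2 * \<tau>) * cnj (u (- t))"
    using refl[of \<tau> "t + 2 * \<tau>"] assms(5) by simp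
  also have "cnj (u (- t)) = u t"
    using refl[of 0 t] assms(4) by simp
  finally show ?thesis .
qed

section \<open>Asymptotics of the field\<close>

text \<open>After pulling out \<open>\<rho> powr (- p)\<close> this is differentiability at 0 in the
  relative increment \<open>h / \<rho>\<close>. The range 2 for \<open>h\<close> leaves room for
  \<open>cos t\<close> plus an error of at most 1.\<close>

lemma powr_neg_increment:
  fixes p :: real
  assumes "\<delta> > 0"
  shows "\<forall>\<^sub>F \<rho> in at_top. \<forall>h. \<bar>h\<bar> \<le> 2 \<longrightarrow>
    \<bar>(\<rho> + h) powr (- p) - \<rho> powr (- p) + p * h * \<rho> powr (- p - 1)\<bar> \<le> \<delta> * \<rho> powr (- p - 1)"
proof -
  have "((\<lambda>x. (1 + x) powr (- p)) has_real_derivative - p) (at 0)"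
    by (auto intro!: derivative_eq_intros)
  then have "\<exists>d>0. \<forall>x. norm (x - 0) < d \<longrightarrow>
      norm ((1 + x) powr (- p) - (1 + 0) powr (- p) - (- p) * (x - 0)) \<le> \<delta> / 2 * norm (x - 0)"
    using half_gt_zero[OF \<open>\<delta> > 0\<close>] unfolding has_field_derivative_def has_derivative_at_alt by blast
  then obtain d where "d > 0" and d: "\<And>x. \<bar>x\<bar> < d \<Longrightarrow> \<bar>(1 + x) powr (- p) - 1 + p * x\<bar> \<le> \<delta> / 2 * \<bar>x\<bar>"
    by auto
  show ?thesis
    using eventually_gt_at_top[of "max 4 (2 / d)"]
  proof (eventually_elim, intro allI impI)
    fix \<rho> h :: real
    assume \<rho>: "\<rho> > max 4 (2 / d)" and h: "\<bar>h\<bar> \<le> 2"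
    define x where "x = h / \<rho>"
    have "2 < \<rho> * d" using \<rho> \<open>d > 0\<close> by (simp add: field_simps)
    then have "\<bar>x\<bar> < d" using \<rho> h by (simp add: x_def field_simps)
    have "\<bar>x\<bar> \<le> 2 / \<rho>" using \<rho> h by (simp add: x_def divide_right_mono)
    have "\<bar>x\<bar> \<le> 1" using \<rho> h by (simp add: x_def)
    have "\<rho> * (1 + x) = \<rho> + h" using \<rho> by (simp add: x_def distrib_left)
    then have "(\<rho> + h) powr (- p) = (\<rho> * (1 + x)) powr (- p)" by simp
    also have "\<dots> = \<rho> powr (- p) * (1 + x) powr (- p)"
      using \<rho> \<open>\<bar>x\<bar> \<le> 1\<close> by (intro powr_mult)
    finally have 1: "(\<rho> + h) powr (- p) = \<rho> powr (- p) * (1 + x) powr (- p)" .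
    have 2: "\<rho> powr (- p - 1) = \<rho> powr (- p) / \<rho>"
      using \<rho> by (simp add: powr_diff)
    have "(\<rho> + h) powr (- p) - \<rho> powr (- p) + p * h * \<rho> powr (- p - 1) =
        \<rho> powr (- p) * ((1 + x) powr (- p) - 1 + p * x)"
      unfolding 1 2 by (simp add: x_def algebra_simps)
    then have "\<bar>(\<rho> + h) powr (- p) - \<rho> powr (- p) + p * h * \<rho> powr (- p - 1)\<bar> =
        \<rho> powr (- p) * \<bar>(1 + x) powr (- p) - 1 + p * x\<bar>"
      by (simp add: abs_mult)
    also have "\<dots> \<le> \<rho> powr (- p) * (\<delta> / 2 * (2 / \<rho>))"
      using \<open>\<bar>x\<bar> \<le> 2 / \<rho>\<close> \<open>\<delta> > 0\<close>
      by (intro mult_left_mono order_trans[OF d[OF \<open>\<bar>x\<bar> < d\<close>]]) (auto intro: mult_left_mono)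
    also have "\<dots> = \<delta> * \<rho> powr (- p - 1)"
      unfolding 2 by simp
    finally show "\<bar>(\<rho> + h) powr (- p) - \<rho> powr (- p) + p * h * \<rho> powr (- p - 1)\<bar>
        \<le> \<delta> * \<rho> powr (- p - 1)" .
  qed
qed

lemma powr_neg_le_scale:
  fixes r \<rho> p :: real
  assumes "\<rho> > 0" "\<rho> / 2 \<le> r" "p \<ge> 0"
  shows "r powr (- p) \<le> 2 powr p * \<rho> powr (- p)"
proof -
  have "r powr (- p) \<le> (\<rho> / 2) powr (- p)"
    using assms by (intro powr_mono2') auto
  also have "\<dots> = 2 powr p * \<rho> powr (- p)"
    using assms by (simp add: powr_divide powr_minus field_simps)
  finally show ?thesis .
qed

section \<open>The radial field far from the origin\<close>

locale asymptotic_field =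
  fixes B :: "complex \<Rightarrow> real" and A A\<^sub>1 \<gamma> \<gamma>\<^sub>1 :: real
  assumes C1: "C1_scalar B" and radial: "radial B"
    and \<gamma>: "1 < \<gamma>" "\<gamma> < \<gamma>\<^sub>1"
    and expansion: "(\<lambda>u. B u - (1 + A * norm u powr (- \<gamma>) + A\<^sub>1 * norm u powr (- \<gamma>\<^sub>1)))
           \<in> o[at_infinity](\<lambda>u. norm u powr (- \<gamma> - 1))"
    and gradient_decay:
      "(\<lambda>u. norm (gradient B u)) \<in> O[at_infinity](\<lambda>u. norm u powr (- min (\<gamma> + 1) \<gamma>\<^sub>1))"
begin

definition b :: "real \<Rightarrow> real" where
  "b r = B (of_real r)"

lemma b_norm: "b (norm z) = B z"
  unfolding b_def by (rule radialD[OF radial]) simp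

text \<open>The cut-off makes the equation of motion globally Lipschitz without changing it far away.\<close>

definition g :: "complex \<Rightarrow> real" where
  "g z = 1 / max (1 / 2) (B z)"

lemma g_pos: "g z > 0" and g_le: "g z \<le> 2"
  by (auto simp: g_def field_simps)

lemma radial_g: "radial g"
  unfolding radial_def g_def
proof (intro allI impI)
  fix u v :: complex
  assume "norm u = norm v"
  then have "B u = B v" by (rule radialD[OF radial])
  then show "1 / max (1 / 2) (B u) = 1 / max (1 / 2) (B v)" by simp
qed

lemma g_lipschitz: obtains L where "\<And>x y. \<bar>g x - g y\<bar> \<le> L * norm (x - y)"
proof -
  obtain L where "\<And>x. norm (gradient B x) \<le> L"
    using bounded_gradient[OF C1 gradient_decay] \<gamma> by auto
  then have L: "\<bar>B x - B y\<bar> \<le> L * norm (x - y)" for x y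
    by (rule C1_scalar_lipschitz[OF C1])
  have "\<bar>g x - g y\<bar> \<le> (4 * L) * norm (x - y)" for x y
  proof -
    define s t where "s = max (1 / 2) (B x)" and "t = max (1 / 2) (B y)"
    have "s \<ge> 1 / 2" "t \<ge> 1 / 2" by (auto simp: s_def t_def)
    then have "s * t \<ge> 1 / 2 * (1 / 2)" by (intro mult_mono) auto
    have "\<bar>g x - g y\<bar> = \<bar>t - s\<bar> / (s * t)"
      using \<open>s \<ge> 1 / 2\<close> \<open>t \<ge> 1 / 2\<close>
      by (simp add: g_def s_def[symmetric] t_def[symmetric] divide_simps abs_mult)
    also have "\<dots> \<le> \<bar>t - s\<bar> / (1 / 2 * (1 / 2))"
      using \<open>s * t \<ge> 1 / 2 * (1 / 2)\<close> by (intro divide_left_mono) auto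
    also have "\<dots> \<le> 4 * \<bar>B x - B y\<bar>" by (auto simp: s_def t_def)
    finally show ?thesis using L[of x y] by simp
  qed
  then show thesis by (rule that)
qed

lemma b_remainder:
  assumes "\<delta> > 0"
  shows "\<forall>\<^sub>F r in at_top. \<bar>b r - (1 + A * r powr (- \<gamma>) + A\<^sub>1 * r powr (- \<gamma>\<^sub>1))\<bar> \<le> \<delta> * r powr (- \<gamma> - 1)"
proof -
  have "\<forall>\<^sub>F u in at_infinity. norm (B u - (1 + A * norm u powr (- \<gamma>) + A\<^sub>1 * norm u powr (- \<gamma>\<^sub>1)))
      \<le> \<delta> * norm (norm u powr (- \<gamma> - 1))"
    using landau_o.smallD[OF expansion \<open>\<delta> > 0\<close>] .
  then obtain R where R: "\<And>u. norm u \<ge> R \<Longrightarrow>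
      \<bar>B u - (1 + A * norm u powr (- \<gamma>) + A\<^sub>1 * norm u powr (- \<gamma>\<^sub>1))\<bar> \<le> \<delta> * norm u powr (- \<gamma> - 1)"
    by (auto simp: eventually_at_infinity)
  show ?thesis
    using eventually_ge_at_top[of "max R 1"]
  proof eventually_elim
    case (elim r)
    then show ?case using R[of "of_real r"] by (simp add: b_def)
  qed
qed

text \<open>Taking differences is essential: the term with \<open>A\<^sub>1\<close> may itself
  exceed the order \<open>\<rho> powr (- \<gamma> - 1)\<close>, but its increment has order
  \<open>\<rho> powr (- \<gamma>\<^sub>1 - 1)\<close>. The remainder of the expansion is small
  enough at each of the two radii separately.\<close>

lemma b_increment:
  assumes "\<delta> > 0"
  shows "\<forall>\<^sub>F \<rho> in at_top. \<forall>h. \<bar>h\<bar> \<le> 2 \<longrightarrow>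
    \<bar>b (\<rho> + h) - b \<rho> + A * \<gamma> * h * \<rho> powr (- \<gamma> - 1)\<bar> \<le> \<delta> * \<rho> powr (- \<gamma> - 1)"
proof -
  \<comment> \<open>The loss in passing from \<open>\<rho> + k\<close> back to \<rho>, as
    \<open>\<rho> + k\<close> is at least \<open>\<rho> / 2\<close>. The budget \<delta> is split
    into four quarters: the remainder at each of the two radii, the \<open>A\<close> term and the
    \<open>A\<^sub>1\<close> term.\<close>
  define c where "c = 2 powr (\<gamma> + 1)"
  have "c \<ge> 1" using \<gamma> by (simp add: c_def ge_one_powr_ge_zero)
  define \<delta>' where "\<delta>' = \<delta> / (4 * c)"
  have "\<delta>' > 0" using \<open>\<delta> > 0\<close> \<open>c \<ge> 1\<close> by (simp add: \<delta>'_def)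
  define \<delta>'' where "\<delta>'' = \<delta> / (4 * (\<bar>A\<bar> + 1))"
  have "\<delta>'' > 0" using \<open>\<delta> > 0\<close> by (simp add: \<delta>''_def add_nonneg_pos)
  obtain R where R: "\<And>r. r \<ge> R \<Longrightarrow>
      \<bar>b r - (1 + A * r powr (- \<gamma>) + A\<^sub>1 * r powr (- \<gamma>\<^sub>1))\<bar> \<le> \<delta>' * r powr (- \<gamma> - 1)"
    using b_remainder[OF \<open>\<delta>' > 0\<close>] by (auto simp: eventually_at_top_linorder)
  have "((\<lambda>\<rho>. \<rho> powr (\<gamma> - \<gamma>\<^sub>1)) \<longlongrightarrow> 0) at_top"
    using \<gamma> by (intro tendsto_neg_powr filterlim_ident) auto
  then have "((\<lambda>\<rho>. \<bar>A\<^sub>1\<bar> * (2 * \<gamma>\<^sub>1 + 1) * \<rho> powr (\<gamma> - \<gamma>\<^sub>1)) \<longlongrightarrow> 0) at_top"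
    by (rule tendsto_mult_right_zero)
  \<comment> \<open>The coefficient \<open>2 * \<gamma>\<^sub>1 + 1\<close> collects the linear
    term, with \<open>h\<close> at most 2 in size, and a Taylor error taken with tolerance
    1.\<close>
  then have "\<forall>\<^sub>F \<rho> in at_top. \<bar>A\<^sub>1\<bar> * (2 * \<gamma>\<^sub>1 + 1) * \<rho> powr (\<gamma> - \<gamma>\<^sub>1) < \<delta> / 4"
    using \<open>\<delta> > 0\<close> by (intro order_tendstoD(2)[of _ 0]) auto
  moreover note powr_neg_increment[OF \<open>\<delta>'' > 0\<close>, of \<gamma>] powr_neg_increment[of 1 \<gamma>\<^sub>1, OF zero_less_one]
    eventually_ge_at_top[of "max 4 (R + 2)"]
  ultimately show ?thesis
  proof (eventually_elim, intro allI impI)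
    fix \<rho> h :: real
    define P where "P = \<rho> powr (- \<gamma> - 1)"
    have "P \<ge> 0" by (simp add: P_def)
    define e where "e r = b r - (1 + A * r powr (- \<gamma>) + A\<^sub>1 * r powr (- \<gamma>\<^sub>1))" for r
    assume A1: "\<bar>A\<^sub>1\<bar> * (2 * \<gamma>\<^sub>1 + 1) * \<rho> powr (\<gamma> - \<gamma>\<^sub>1) < \<delta> / 4"
      and i1: "\<forall>h. \<bar>h\<bar> \<le> 2 \<longrightarrow> \<bar>(\<rho> + h) powr (- \<gamma>) - \<rho> powr (- \<gamma>) + \<gamma> * h * \<rho> powr (- \<gamma> - 1)\<bar>
          \<le> \<delta>'' * \<rho> powr (- \<gamma> - 1)"
      and i2: "\<forall>h. \<bar>h\<bar> \<le> 2 \<longrightarrow> \<bar>(\<rho> + h) powr (- \<gamma>\<^sub>1) - \<rho> powr (- \<gamma>\<^sub>1) + \<gamma>\<^sub>1 * h * \<rho> powr (- \<gamma>\<^sub>1 - 1)\<bar>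
          \<le> 1 * \<rho> powr (- \<gamma>\<^sub>1 - 1)"
      and \<rho>: "max 4 (R + 2) \<le> \<rho>" and h: "\<bar>h\<bar> \<le> 2"
    have e: "\<bar>e (\<rho> + k)\<bar> \<le> \<delta> / 4 * P" if "\<bar>k\<bar> \<le> 2" for k
    proof -
      have "\<bar>e (\<rho> + k)\<bar> \<le> \<delta>' * (\<rho> + k) powr (- (\<gamma> + 1))"
        using R[of "\<rho> + k"] \<rho> that by (simp add: e_def abs_le_iff)
      also have "\<dots> \<le> \<delta>' * (c * \<rho> powr (- (\<gamma> + 1)))"
        unfolding c_def using \<rho> that \<gamma> \<open>\<delta>' > 0\<close> by (intro mult_left_mono powr_neg_le_scale) auto
      also have "\<dots> = \<delta> / 4 * P" using \<open>c \<ge> 1\<close> by (simp add: \<delta>'_def P_def)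
      finally show ?thesis .
    qed
    define x where "x = (\<rho> + h) powr (- \<gamma>) - \<rho> powr (- \<gamma>) + \<gamma> * h * P"
    define y where "y = (\<rho> + h) powr (- \<gamma>\<^sub>1) - \<rho> powr (- \<gamma>\<^sub>1)"
    have "\<bar>A * x\<bar> \<le> \<delta> / 4 * P"
    proof -
      have "\<bar>A * x\<bar> \<le> \<bar>A\<bar> * (\<delta>'' * P)"
        unfolding abs_mult using i1 h by (intro mult_left_mono) (auto simp: x_def P_def)
      also have "\<dots> \<le> (\<bar>A\<bar> + 1) * (\<delta>'' * P)"
        using \<open>\<delta>'' > 0\<close> \<open>P \<ge> 0\<close> by (intro mult_right_mono) auto
      also have "\<dots> = \<delta> / 4 * P" using abs_ge_zero[of A] by (simp add: \<delta>''_def add_nonneg_eq_0_iff divide_simps)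
      finally show ?thesis .
    qed
    moreover have "\<bar>A\<^sub>1 * y\<bar> \<le> \<delta> / 4 * P"
    proof -
      define P1 where "P1 = \<rho> powr (- \<gamma>\<^sub>1 - 1)"
      have "P1 \<ge> 0" by (simp add: P1_def)
      have "\<bar>\<gamma>\<^sub>1 * h * P1\<bar> \<le> \<gamma>\<^sub>1 * 2 * P1"
        using \<gamma> h \<open>P1 \<ge> 0\<close> by (simp add: abs_mult mult_right_mono mult_left_mono)
      moreover have "\<bar>y + \<gamma>\<^sub>1 * h * P1\<bar> \<le> P1" using i2 h by (simp add: y_def P1_def)
      ultimately have "\<bar>y\<bar> \<le> (2 * \<gamma>\<^sub>1 + 1) * P1" by (simp add: algebra_simps abs_le_iff)
      then have "\<bar>A\<^sub>1 * y\<bar> \<le> \<bar>A\<^sub>1\<bar> * ((2 * \<gamma>\<^sub>1 + 1) * P1)"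
        unfolding abs_mult by (intro mult_left_mono) auto
      also have "P1 = \<rho> powr (\<gamma> - \<gamma>\<^sub>1) * P"
        by (simp add: P1_def P_def powr_add[symmetric])
      also have "\<bar>A\<^sub>1\<bar> * ((2 * \<gamma>\<^sub>1 + 1) * \<dots>) \<le> \<delta> / 4 * P"
        using mult_right_mono[OF less_imp_le[OF A1] \<open>P \<ge> 0\<close>] by (simp add: mult_ac)
      finally show ?thesis .
    qed
    moreover have "\<bar>e (\<rho> + h)\<bar> \<le> \<delta> / 4 * P" "\<bar>e (\<rho> + 0)\<bar> \<le> \<delta> / 4 * P"
      using h e[of h] e[of 0] by (simp_all del: add_0_right)
    moreover have "b (\<rho> + h) - b \<rho> + A * \<gamma> * h * P = e (\<rho> + h) - e (\<rho> + 0) + A * x + A\<^sub>1 * y"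
      by (simp add: e_def x_def y_def algebra_simps)
    ultimately show "\<bar>b (\<rho> + h) - b \<rho> + A * \<gamma> * h * P\<bar> \<le> \<delta> * P"
      by linarith
  qed
qed

text \<open>The margin 20 is the distance covered in time 10 at speed at most 2. The gradient obeys
  the same bound because both \<open>\<gamma> + 1\<close> and \<open>\<gamma>\<^sub>1\<close> exceed
  \<gamma>.\<close>

lemma B_decay:
  obtains C where "C > 0"
    "\<forall>\<^sub>F \<rho> in at_top. \<forall>z. norm z \<ge> \<rho> - 20 \<longrightarrow> B z \<ge> 1 / 2 \<and> g z = 1 / B z \<and>
       \<bar>B z - 1\<bar> \<le> C * \<rho> powr (- \<gamma>) \<and> \<bar>g z - 1\<bar> \<le> C * \<rho> powr (- \<gamma>) \<and>
       norm (gradient B z) \<le> C * \<rho> powr (- \<gamma>)"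
proof -
  obtain R where R: "\<And>r. r \<ge> R \<Longrightarrow>
      \<bar>b r - (1 + A * r powr (- \<gamma>) + A\<^sub>1 * r powr (- \<gamma>\<^sub>1))\<bar> \<le> 1 * r powr (- \<gamma> - 1)"
    using b_remainder[of 1] by (auto simp: eventually_at_top_linorder)
  obtain c where "c > 0" and "\<forall>\<^sub>F u in at_infinity. norm (gradient B u) \<le>
      c * norm u powr (- min (\<gamma> + 1) \<gamma>\<^sub>1)"
    using landau_o.bigE[OF gradient_decay] by auto
  then obtain R' where R': "\<And>u. norm u \<ge> R' \<Longrightarrow> norm (gradient B u) \<le>
      c * norm u powr (- min (\<gamma> + 1) \<gamma>\<^sub>1)"
    by (auto simp: eventually_at_infinity)
  define c1 where "c1 = \<bar>A\<bar> + \<bar>A\<^sub>1\<bar> + 1"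
  define q where "q = 2 powr \<gamma>"
  \<comment> \<open>The factor 2 pays for passing from \<open>B\<close> to its reciprocal where
    \<open>B\<close> is at least 1/2; \<open>q\<close> pays for replacing the radius by
    \<rho>.\<close>
  define C where "C = max (2 * c1 * q) (c * q)"
  have "c1 > 0" "q > 0" by (auto simp: c1_def q_def)
  then have "C > 0" using \<open>c > 0\<close> by (simp add: C_def less_max_iff_disj)
  have "((\<lambda>\<rho>. C * \<rho> powr (- \<gamma>)) \<longlongrightarrow> 0) at_top"
    using \<gamma> by (intro tendsto_mult_right_zero tendsto_neg_powr filterlim_ident) auto
  then have "\<forall>\<^sub>F \<rho> in at_top. C * \<rho> powr (- \<gamma>) < 1 / 2"
    by (intro order_tendstoD(2)[of _ 0]) auto
  \<comment> \<open>From 40 on, \<open>\<rho> - 20\<close> is at least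
    \<open>\<rho> / 2\<close>.\<close>
  moreover note eventually_ge_at_top[of "max 40 (max R R' + 20)"]
  ultimately have "\<forall>\<^sub>F \<rho> in at_top. \<forall>z. norm z \<ge> \<rho> - 20 \<longrightarrow> B z \<ge> 1 / 2 \<and> g z = 1 / B z \<and>
       \<bar>B z - 1\<bar> \<le> C * \<rho> powr (- \<gamma>) \<and> \<bar>g z - 1\<bar> \<le> C * \<rho> powr (- \<gamma>) \<and>
       norm (gradient B z) \<le> C * \<rho> powr (- \<gamma>)"
  proof (eventually_elim, intro allI impI)
    fix \<rho> z
    assume small: "C * \<rho> powr (- \<gamma>) < 1 / 2" and \<rho>: "max 40 (max R R' + 20) \<le> \<rho>"
      and z: "\<rho> - 20 \<le> norm (z :: complex)"
    define r where "r = norm z"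
    have r: "r \<ge> 1" "r \<ge> R" "r \<ge> R'" "\<rho> / 2 \<le> r" using \<rho> z by (auto simp: r_def)
    have p: "r powr (- s) \<le> r powr (- \<gamma>)" if "s \<ge> \<gamma>" for s
      using r that by (intro powr_mono) auto
    have scale: "r powr (- \<gamma>) \<le> q * \<rho> powr (- \<gamma>)"
      unfolding q_def using \<rho> r \<gamma> by (intro powr_neg_le_scale) auto
    have "\<bar>B z - 1\<bar> \<le> \<bar>A * r powr (- \<gamma>)\<bar> + \<bar>A\<^sub>1 * r powr (- \<gamma>\<^sub>1)\<bar> + r powr (- (\<gamma> + 1))"
      using R[OF \<open>r \<ge> R\<close>] by (simp add: r_def b_norm)
    also have "\<dots> \<le> \<bar>A\<bar> * r powr (- \<gamma>) + \<bar>A\<^sub>1\<bar> * r powr (- \<gamma>) + r powr (- \<gamma>)"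
      using p[of \<gamma>\<^sub>1] p[of "\<gamma> + 1"] \<gamma> by (intro add_mono) (auto simp: abs_mult intro: mult_left_mono)
    also have "\<dots> = c1 * r powr (- \<gamma>)" by (simp add: c1_def algebra_simps)
    also have "\<dots> \<le> c1 * (q * \<rho> powr (- \<gamma>))"
      using \<open>c1 > 0\<close> by (intro mult_left_mono scale) auto
    finally have "2 * \<bar>B z - 1\<bar> \<le> 2 * c1 * q * \<rho> powr (- \<gamma>)" by simp
    also have "\<dots> \<le> C * \<rho> powr (- \<gamma>)" by (intro mult_right_mono) (auto simp: C_def)
    finally have B2: "2 * \<bar>B z - 1\<bar> \<le> C * \<rho> powr (- \<gamma>)" .
    have "2 * \<bar>B z - 1\<bar> < 1 / 2" by (rule le_less_trans[OF B2 small])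
    then have Bh: "B z \<ge> 1 / 2" by (simp add: abs_if split: if_splits)
    then have gB: "g z = 1 / B z" by (simp add: g_def max_def)
    have "\<bar>g z - 1\<bar> = \<bar>B z - 1\<bar> / B z"
      unfolding gB using Bh by (simp add: divide_simps abs_if)
    also have "\<dots> \<le> \<bar>B z - 1\<bar> / (1 / 2)"
      using Bh by (intro divide_left_mono) auto
    finally have "\<bar>g z - 1\<bar> \<le> C * \<rho> powr (- \<gamma>)" using B2 by simp
    moreover have "norm (gradient B z) \<le> C * \<rho> powr (- \<gamma>)"
    proof -
      have "norm (gradient B z) \<le> c * r powr (- min (\<gamma> + 1) \<gamma>\<^sub>1)"
        using R'[of z] r by (simp add: r_def)
      also have "\<dots> \<le> c * (q * \<rho> powr (- \<gamma>))"
        using \<open>c > 0\<close> p[of "min (\<gamma> + 1) \<gamma>\<^sub>1"] \<gamma> by (intro mult_left_mono order_trans[OF _ scale]) auto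
      also have "\<dots> \<le> C * \<rho> powr (- \<gamma>)"
        unfolding mult.assoc[symmetric] by (intro mult_right_mono) (auto simp: C_def)
      finally show ?thesis .
    qed
    moreover have "\<bar>B z - 1\<bar> \<le> C * \<rho> powr (- \<gamma>)" 
      by (rule order_trans[OF _ B2]) simp
    ultimately show "B z \<ge> 1 / 2 \<and> g z = 1 / B z \<and>
       \<bar>B z - 1\<bar> \<le> C * \<rho> powr (- \<gamma>) \<and> \<bar>g z - 1\<bar> \<le> C * \<rho> powr (- \<gamma>) \<and>
       norm (gradient B z) \<le> C * \<rho> powr (- \<gamma>)"
      using Bh gB by blast
  qed
  then show thesis using \<open>C > 0\<close> that by blast
qed

text \<open>Far out, the increment of \<open>g\<close> is minus the increment of \<open>B\<close>
  times the product of two values of \<open>g\<close>. That product tends to 1, so the expansion of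
  \<open>B\<close> carries over with the opposite sign.\<close>

lemma g_increment:
  assumes "\<delta> > 0"
  shows "\<forall>\<^sub>F \<rho> in at_top. \<forall>z. \<bar>norm z - \<rho>\<bar> \<le> 2 \<longrightarrow>
    \<bar>g z - g (of_real \<rho>) - A * \<gamma> * (norm z - \<rho>) * \<rho> powr (- \<gamma> - 1)\<bar> \<le> \<delta> * \<rho> powr (- \<gamma> - 1)"
proof -
  obtain C where "C > 0" and C: "\<forall>\<^sub>F \<rho> in at_top. \<forall>z. norm z \<ge> \<rho> - 20 \<longrightarrow> B z \<ge> 1 / 2 \<and> g z = 1 / B z \<and>
       \<bar>B z - 1\<bar> \<le> C * \<rho> powr (- \<gamma>) \<and> \<bar>g z - 1\<bar> \<le> C * \<rho> powr (- \<gamma>) \<and>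
       norm (gradient B z) \<le> C * \<rho> powr (- \<gamma>)"
    using B_decay by blast
  define K where "K = \<bar>A\<bar> * \<gamma> * 2"
  have "K \<ge> 0" using \<gamma> by (simp add: K_def)
  have "((\<lambda>\<rho>. (3 * K * C) * \<rho> powr (- \<gamma>)) \<longlongrightarrow> 0) at_top"
    using \<gamma> by (intro tendsto_mult_right_zero tendsto_neg_powr filterlim_ident) auto
  then have "\<forall>\<^sub>F \<rho> in at_top. (3 * K * C) * \<rho> powr (- \<gamma>) < \<delta> / 2"
    using \<open>\<delta> > 0\<close> by (intro order_tendstoD(2)[of _ 0]) auto
  moreover have "\<delta> / 8 > 0" using \<open>\<delta> > 0\<close> by simp
  note b_increment[OF this]
  moreover note C eventually_ge_at_top[of 2]
  ultimately show ?thesis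
  proof (eventually_elim, intro allI impI)
    fix \<rho> :: real and z :: complex
    define P where "P = \<rho> powr (- \<gamma> - 1)"
    define Q where "Q = C * \<rho> powr (- \<gamma>)"
    have "P \<ge> 0" by (simp add: P_def)
    define h where "h = norm z - \<rho>"
    assume small: "3 * K * C * \<rho> powr (- \<gamma>) < \<delta> / 2"
      and inc: "\<forall>h. \<bar>h\<bar> \<le> 2 \<longrightarrow> \<bar>b (\<rho> + h) - b \<rho> + A * \<gamma> * h * \<rho> powr (- \<gamma> - 1)\<bar> \<le> \<delta> / 8 * \<rho> powr (- \<gamma> - 1)"
      and C: "\<forall>z. norm z \<ge> \<rho> - 20 \<longrightarrow> B z \<ge> 1 / 2 \<and> g z = 1 / B z \<and>
       \<bar>B z - 1\<bar> \<le> C * \<rho> powr (- \<gamma>) \<and> \<bar>g z - 1\<bar> \<le> C * \<rho> powr (- \<gamma>) \<and>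
       norm (gradient B z) \<le> C * \<rho> powr (- \<gamma>)"
      and "2 \<le> \<rho>" and h: "\<bar>norm z - \<rho>\<bar> \<le> 2"
    have z0: "norm z \<ge> \<rho> - 20" using h by linarith
    have z: "B z \<ge> 1 / 2" "g z = 1 / B z" "\<bar>g z - 1\<bar> \<le> Q"
      using C[rule_format, of z, OF z0] unfolding Q_def by blast+
    have r: "B (of_real \<rho>) \<ge> 1 / 2" "g (of_real \<rho>) = 1 / B (of_real \<rho>)" "\<bar>g (of_real \<rho>) - 1\<bar> \<le> Q"
      using C[rule_format, of "of_real \<rho>"] \<open>2 \<le> \<rho>\<close> by (auto simp: Q_def)
    define X where "X = A * \<gamma> * h * P"
    define \<Delta> where "\<Delta> = B z - B (of_real \<rho>)"
    define p where "p = g z * g (of_real \<rho>)"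
    have \<Delta>: "\<bar>\<Delta> + X\<bar> \<le> \<delta> / 8 * P"
    proof -
      have "b (\<rho> + h) = B z" "b \<rho> = B (of_real \<rho>)"
        using b_norm[of z] by (simp_all add: h_def b_def)
      then show ?thesis using inc[rule_format, of h] h by (simp add: \<Delta>_def X_def P_def h_def)
    qed
    have X: "\<bar>X\<bar> \<le> K * P"
    proof -
      have "\<bar>X\<bar> = (\<bar>A\<bar> * \<gamma> * \<bar>h\<bar>) * P" using \<gamma> \<open>P \<ge> 0\<close> by (simp add: X_def abs_mult)
      also have "\<dots> \<le> (\<bar>A\<bar> * \<gamma> * 2) * P"
        using h \<gamma> \<open>P \<ge> 0\<close> by (intro mult_right_mono mult_left_mono) (auto simp: h_def)
      finally show ?thesis by (simp add: K_def)
    qed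
    have p1: "\<bar>p - 1\<bar> \<le> 3 * Q"
    proof -
      have "p - 1 = g z * (g (of_real \<rho>) - 1) + (g z - 1)" by (simp add: p_def algebra_simps)
      also have "\<bar>\<dots>\<bar> \<le> \<bar>g z * (g (of_real \<rho>) - 1)\<bar> + \<bar>g z - 1\<bar>" by (rule abs_triangle_ineq)
      also have "\<bar>g z * (g (of_real \<rho>) - 1)\<bar> \<le> 2 * Q"
        unfolding abs_mult using g_pos[of z] g_le[of z] r by (intro mult_mono) auto
      finally show ?thesis using z by linarith
    qed
    have p2: "\<bar>p\<bar> \<le> 4"
      unfolding p_def abs_mult using g_pos g_le mult_mono[of "\<bar>g z\<bar>" 2 "\<bar>g (of_real \<rho>)\<bar>" 2]
      by (auto simp: less_imp_le)
    \<comment> \<open>Here \<open>X\<close> is minus the predicted increment of \<open>B\<close>.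
      The first product is small because \<open>p\<close> is close to 1, the second because
      \<open>\<Delta> + X\<close> is; the bound 4 on \<open>p\<close> explains the tolerance
      \<open>\<delta> / 8\<close>.\<close>
    have "g z - g (of_real \<rho>) - X = X * (p - 1) - p * (\<Delta> + X)"
      unfolding \<Delta>_def p_def z(2) r(2) using z(1) r(1) by (simp add: field_simps)
    also have "\<bar>\<dots>\<bar> \<le> \<bar>X * (p - 1)\<bar> + \<bar>p * (\<Delta> + X)\<bar>" by (rule abs_triangle_ineq4)
    also have "\<dots> \<le> (K * P) * (3 * Q) + 4 * (\<delta> / 8 * P)"
      unfolding abs_mult using X p1 p2 \<Delta> by (intro add_mono mult_mono) auto
    also have "\<dots> = (3 * K * Q) * P + \<delta> / 2 * P" by simp
    also have "(3 * K * Q) * P \<le> \<delta> / 2 * P"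
      using small \<open>P \<ge> 0\<close> by (intro mult_right_mono) (auto simp: Q_def mult_ac)
    finally show "\<bar>g z - g (of_real \<rho>) - A * \<gamma> * (norm z - \<rho>) * \<rho> powr (- \<gamma> - 1)\<bar>
        \<le> \<delta> * \<rho> powr (- \<gamma> - 1)"
      by (simp add: X_def P_def h_def)
  qed
qed

end

section \<open>The drift of a solution\<close>

lemma cis_has_vector_derivative:
  "((\<lambda>t. cis (k * t)) has_vector_derivative \<i> * k * cis (k * t)) (at t)"
  unfolding cis_conv_exp
  by (rule derivative_eq_intros has_vector_derivative_real_field refl | simp)+

text \<open>The initial value is that of the reference curve at time 0. It is real, so the real axis
  is crossed normally for every \<rho>, and \<rho> remains as the free parameter.\<close>

locale angle_flow = asymptotic_field +
  fixes u :: "real \<Rightarrow> real \<Rightarrow> complex"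
  assumes u_0: "u \<rho> 0 = of_real \<rho> + 1"
    and u_solution: "angle_solution g (u \<rho>)"
    and u_continuous: "continuous_on UNIV (\<lambda>\<rho>. u \<rho> t)"
begin

lemma u_deriv: "(u \<rho> has_vector_derivative angle_field g t (u \<rho> t)) (at t)"
  using u_solution by (simp add: angle_solution_def)

lemma u_norm_ge:
  assumes "\<bar>t\<bar> \<le> 10"
  shows "norm (u \<rho> t) \<ge> \<rho> - 20"
proof -
  have "norm (u \<rho> t - u \<rho> 0) \<le> 2 * \<bar>t - 0\<bar>"
    by (rule norm_increment_abs_le[OF u_deriv]) (use g_pos g_le in \<open>simp add: less_imp_le\<close>)
  then have "norm (u \<rho> t - u \<rho> 0) \<le> 2 * \<bar>t\<bar>" by simp
  moreover have "\<rho> + 1 \<le> norm (u \<rho> 0)"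
    unfolding u_0 using complex_Re_le_cmod[of "of_real \<rho> + 1"] by simp
  moreover have "norm (u \<rho> 0) \<le> norm (u \<rho> t) + norm (u \<rho> t - u \<rho> 0)"
    by (metis norm_minus_commute norm_triangle_sub)
  ultimately show ?thesis using assms by linarith
qed

text \<open>Zeroth order information: the speed is within order
  \<open>\<rho> powr (- \<gamma>)\<close> of 1. The window up to 8 comfortably contains the crossing
  times, which are close to \<pi>.\<close>

lemma u_approx:
  obtains C where "\<forall>\<^sub>F \<rho> in at_top. \<forall>t\<in>{0..8}.
    norm (u \<rho> t - (of_real \<rho> + cis t)) \<le> C * \<rho> powr (- \<gamma>)"
proof -
  obtain C where C: "\<forall>\<^sub>F \<rho> in at_top. \<forall>z. norm z \<ge> \<rho> - 20 \<longrightarrow> B z \<ge> 1 / 2 \<and> g z = 1 / B z \<and>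
       \<bar>B z - 1\<bar> \<le> C * \<rho> powr (- \<gamma>) \<and> \<bar>g z - 1\<bar> \<le> C * \<rho> powr (- \<gamma>) \<and>
       norm (gradient B z) \<le> C * \<rho> powr (- \<gamma>)"
    using B_decay by blast
  have "\<forall>\<^sub>F \<rho> in at_top. \<forall>t\<in>{0..8}. norm (u \<rho> t - (of_real \<rho> + cis t)) \<le> (8 * C) * \<rho> powr (- \<gamma>)"
    using C
  proof eventually_elim
    case (elim \<rho>)
    show ?case
    proof
      fix t :: real
      assume t: "t \<in> {0..8}"
      define w where "w t = u \<rho> t - (of_real \<rho> + cis t)" for t
      have "norm (w t - w 0) \<le> (C * \<rho> powr (- \<gamma>)) * (t - 0)"
      proof (rule norm_increment_le)
        fix s assume "s \<in> {0..t}"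
        have "(w has_vector_derivative angle_field g s (u \<rho> s) - (0 + \<i> * of_real 1 * cis (1 * s))) (at s)"
          unfolding w_def using cis_has_vector_derivative[of 1 s]
          by (intro has_vector_derivative_diff has_vector_derivative_add u_deriv has_vector_derivative_const) simp
        also have "angle_field g s (u \<rho> s) - (0 + \<i> * of_real 1 * cis (1 * s)) = (g (u \<rho> s) - 1) *\<^sub>R (\<i> * cis s)"
          by (simp add: angle_field_def algebra_simps)
        finally show "(w has_vector_derivative (g (u \<rho> s) - 1) *\<^sub>R (\<i> * cis s)) (at s)" .
        have "norm (u \<rho> s) \<ge> \<rho> - 20"
          using \<open>s \<in> {0..t}\<close> t by (intro u_norm_ge) auto
        with elim have "\<bar>g (u \<rho> s) - 1\<bar> \<le> C * \<rho> powr (- \<gamma>)" by blast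
        then show "norm ((g (u \<rho> s) - 1) *\<^sub>R (\<i> * cis s)) \<le> C * \<rho> powr (- \<gamma>)"
          by (simp add: norm_mult)
      qed (use t in auto)
      also have "\<dots> \<le> (C * \<rho> powr (- \<gamma>)) * 8"
      \<comment> \<open>The sign of \<open>C\<close> is not recorded here; the estimate at time 0
        shows that the bound is nonnegative.\<close>
      proof (rule mult_left_mono)
        have "norm (u \<rho> 0) \<ge> \<rho> - 20" by (intro u_norm_ge) auto
        with elim have "\<bar>g (u \<rho> 0) - 1\<bar> \<le> C * \<rho> powr (- \<gamma>)" by blast
        then show "0 \<le> C * \<rho> powr (- \<gamma>)" by (rule order_trans[OF abs_ge_zero])
      qed (use t in auto)
      finally show "norm (u \<rho> t - (of_real \<rho> + cis t)) \<le> (8 * C) * \<rho> powr (- \<gamma>)"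
        by (simp add: w_def u_0 mult_ac)
    qed
  qed
  then show thesis by (rule that)
qed

text \<open>The imaginary part enters the norm of \<open>\<rho> + cis t\<close> only at order
  \<open>1 / \<rho>\<close>: with \<open>a\<close> the real part, the squares of the norm and of
  \<open>a\<close> differ by \<open>(sin t)\<^sup>2\<close>, and factoring the difference of squares
  divides this by about \<open>2 * \<rho>\<close>.\<close>

lemma u_radius:
  assumes "\<delta> > 0"
  shows "\<forall>\<^sub>F \<rho> in at_top. \<forall>t\<in>{0..8}. \<bar>norm (u \<rho> t) - \<rho> - cos t\<bar> \<le> \<delta>"
proof -
  obtain C where C: "\<forall>\<^sub>F \<rho> in at_top. \<forall>t\<in>{0..8}.
    norm (u \<rho> t - (of_real \<rho> + cis t)) \<le> C * \<rho> powr (- \<gamma>)"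
    by (rule u_approx)
  have "((\<lambda>\<rho>. C * \<rho> powr (- \<gamma>)) \<longlongrightarrow> 0) at_top"
    using \<gamma> by (intro tendsto_mult_right_zero tendsto_neg_powr filterlim_ident) auto
  then have "\<forall>\<^sub>F \<rho> in at_top. C * \<rho> powr (- \<gamma>) < \<delta> / 2"
    using \<open>\<delta> > 0\<close> by (intro order_tendstoD(2)[of _ 0]) auto
  with C show ?thesis
    using eventually_ge_at_top[of "2 + 2 / \<delta>"]
  proof eventually_elim
    case (elim \<rho>)
    have "2 / \<delta> > 0" using \<open>\<delta> > 0\<close> by simp
    then have \<rho>: "\<rho> - 1 \<ge> 1" "\<rho> - 1 \<ge> 2 / \<delta>" using elim(3) by linarith+
    show ?case
    proof
      fix t :: real
      assume t: "t \<in> {0..8}"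
      define z where "z = of_real \<rho> + cis t"
      define a where "a = \<rho> + cos t"
      have a: "a \<ge> \<rho> - 1" using cos_ge_minus_one[of t] by (simp add: a_def)
      have Re: "Re z = a" and Im: "Im z = sin t" by (auto simp: z_def a_def)
      have "norm z \<ge> a" using complex_Re_le_cmod[of z] Re by simp
      have "(norm z - a) * (norm z + a) = (sin t)\<^sup>2"
        using cmod_power2[of z] Re Im by (simp add: algebra_simps power2_eq_square)
      also have "\<dots> \<le> 1" by (simp add: abs_square_le_1)
      finally have "(norm z - a) * (norm z + a) \<le> 1" .
      moreover have "(norm z - a) * (2 / \<delta>) \<le> (norm z - a) * (norm z + a)"
        using \<open>norm z \<ge> a\<close> a \<rho> by (intro mult_left_mono) auto
      ultimately have "(norm z - a) * (2 / \<delta>) \<le> 1" by linarith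
      then have "norm z - a \<le> \<delta> / 2" using \<open>\<delta> > 0\<close> by (simp add: field_simps)
      moreover have "\<bar>norm (u \<rho> t) - norm z\<bar> \<le> \<delta> / 2"
        using norm_triangle_ineq3[of "u \<rho> t" z] elim(1) elim(2) t unfolding z_def by fastforce
      ultimately show "\<bar>norm (u \<rho> t) - \<rho> - cos t\<bar> \<le> \<delta>"
        using \<open>norm z \<ge> a\<close> unfolding a_def by linarith
    qed
  qed
qed

lemma g_along_u:
  assumes "\<delta> > 0"
  shows "\<forall>\<^sub>F \<rho> in at_top. \<forall>t\<in>{0..8}.
    \<bar>g (u \<rho> t) - g (of_real \<rho>) - A * \<gamma> * \<rho> powr (- \<gamma> - 1) * cos t\<bar> \<le> \<delta> * \<rho> powr (- \<gamma> - 1)"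
proof -
  define K where "K = \<bar>A\<bar> * \<gamma> + 1"
  have "K > 0" using \<gamma> by (simp add: K_def add_nonneg_pos)
  \<comment> \<open>At most 1, to keep the radial increment within the range 2 of
    \<open>g_increment\<close>; the other entry limits the cost of replacing the increment by
    \<open>cos t\<close> to half of \<delta>.\<close>
  define \<delta>' where "\<delta>' = min 1 (\<delta> / (2 * K))"
  have "\<delta>' > 0" using \<open>\<delta> > 0\<close> \<open>K > 0\<close> by (simp add: \<delta>'_def)
  have "\<delta> / 2 > 0" using \<open>\<delta> > 0\<close> by simp
  show ?thesis
    using g_increment[OF \<open>\<delta> / 2 > 0\<close>] u_radius[OF \<open>\<delta>' > 0\<close>]
  proof eventually_elim
    case (elim \<rho>)
    show ?case
    proof
      fix t :: real
      assume t: "t \<in> {0..8}"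
      define P where "P = \<rho> powr (- \<gamma> - 1)"
      have "P \<ge> 0" by (simp add: P_def)
      define r where "r = norm (u \<rho> t) - \<rho>"
      have r: "\<bar>r - cos t\<bar> \<le> \<delta>'" using elim(2) t by (auto simp: r_def)
      have "\<bar>r\<bar> \<le> \<bar>r - cos t\<bar> + \<bar>cos t\<bar>" by linarith
      also have "\<delta>' \<le> 1" by (simp add: \<delta>'_def)
      then have "\<bar>r - cos t\<bar> + \<bar>cos t\<bar> \<le> 2" using r abs_cos_le_one[of t] by linarith
      finally have 1: "\<bar>g (u \<rho> t) - g (of_real \<rho>) - A * \<gamma> * r * P\<bar> \<le> \<delta> / 2 * P"
        using elim(1) by (simp add: r_def P_def)
      have "\<bar>A * \<gamma> * P * (r - cos t)\<bar> = (\<bar>A\<bar> * \<gamma>) * \<bar>r - cos t\<bar> * P"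
        using \<gamma> \<open>P \<ge> 0\<close> by (simp add: abs_mult)
      also have "\<dots> \<le> K * (\<delta> / (2 * K)) * P"
        using r \<gamma> \<open>P \<ge> 0\<close> \<open>K > 0\<close> by (intro mult_right_mono mult_mono) (auto simp: K_def \<delta>'_def)
      also have "\<dots> = \<delta> / 2 * P" using \<open>K > 0\<close> by simp
      finally have 2: "\<bar>A * \<gamma> * P * (r - cos t)\<bar> \<le> \<delta> / 2 * P" .
      have "g (u \<rho> t) - g (of_real \<rho>) - A * \<gamma> * P * cos t =
          (g (u \<rho> t) - g (of_real \<rho>) - A * \<gamma> * r * P) + A * \<gamma> * P * (r - cos t)"
        by (simp add: algebra_simps)
      also have "\<bar>\<dots>\<bar> \<le> \<delta> / 2 * P + \<delta> / 2 * P"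
        by (rule order_trans[OF abs_triangle_ineq add_mono[OF 1 2]])
      finally show "\<bar>g (u \<rho> t) - g (of_real \<rho>) - A * \<gamma> * \<rho> powr (- \<gamma> - 1) * cos t\<bar>
          \<le> \<delta> * \<rho> powr (- \<gamma> - 1)"
        by (simp add: P_def)
    qed
  qed
qed

text \<open>The solution of the equation in which \<open>g (u \<rho> t)\<close> is replaced by its expansion
  \<open>g \<rho> + A \<gamma> \<rho>\<^sup>-\<^sup>\<gamma>\<^sup>-\<^sup>1 cos t\<close>; its secular term \<open>\<i> t / 2\<close> is the drift.\<close>

definition model :: "real \<Rightarrow> real \<Rightarrow> complex" where
  "model \<rho> t = of_real \<rho> + cis t + of_real (g (of_real \<rho>) - 1) * (cis t - 1) +
     of_real (A * \<gamma> * \<rho> powr (- \<gamma> - 1)) * (cis (2 * t) / 4 + \<i> * of_real t / 2 - 1 / 4)"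

lemma model_0: "model \<rho> 0 = of_real \<rho> + 1"
  by (simp add: model_def)

lemma model_deriv:
  "(model \<rho> has_vector_derivative
     (g (of_real \<rho>) + A * \<gamma> * \<rho> powr (- \<gamma> - 1) * cos t) *\<^sub>R (\<i> * cis t)) (at t)"
proof -
  define K M where "K = g (of_real \<rho>) - 1" and "M = A * \<gamma> * \<rho> powr (- \<gamma> - 1)"
  \<comment> \<open>Hence \<open>cos t * cis t\<close> has mean 1/2; this constant part is the
    resonance that integrates to the secular term.\<close>
  have c: "cis (2 * t) = 2 * cos t * cis t - 1"
    by (simp add: complex_eq_iff cos_double_cos sin_double power2_eq_square)
  have "(model \<rho> has_vector_derivative
      0 + \<i> * of_real 1 * cis (1 * t) + of_real K * (\<i> * of_real 1 * cis (1 * t) - 0) +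
      of_real M * ((\<i> * of_real 2 * cis (2 * t)) / 4 + (\<i> * 1) / 2 - 0)) (at t)"
    unfolding model_def[abs_def] K_def[symmetric] M_def[symmetric]
    using cis_has_vector_derivative[of 1 t] cis_has_vector_derivative[of 2 t]
      has_vector_derivative_of_real[OF DERIV_ident, of "at t"]
    by (intro has_vector_derivative_add has_vector_derivative_diff has_vector_derivative_const
        has_vector_derivative_mult_right has_vector_derivative_divide has_vector_derivative_of_real) auto
  moreover have "0 + \<i> * of_real 1 * cis (1 * t) + of_real K * (\<i> * of_real 1 * cis (1 * t) - 0) +
      of_real M * ((\<i> * of_real 2 * cis (2 * t)) / 4 + (\<i> * 1) / 2 - 0) =
      (1 + K + M * cos t) *\<^sub>R (\<i> * cis t)"
    unfolding c by (simp add: scaleR_conv_of_real field_simps)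
  ultimately show ?thesis by (simp add: K_def M_def)
qed

lemma u_model:
  assumes "\<delta> > 0"
  shows "\<forall>\<^sub>F \<rho> in at_top. \<forall>t\<in>{0..8}. norm (u \<rho> t - model \<rho> t) \<le> \<delta> * \<rho> powr (- \<gamma> - 1)"
proof -
  have "\<delta> / 8 > 0" using \<open>\<delta> > 0\<close> by simp
  show ?thesis
    using g_along_u[OF \<open>\<delta> / 8 > 0\<close>]
  proof eventually_elim
    case (elim \<rho>)
    show ?case
    proof
      fix t :: real
      assume t: "t \<in> {0..8}"
      define w where "w t = u \<rho> t - model \<rho> t" for t
      have "norm (w t - w 0) \<le> (\<delta> / 8 * \<rho> powr (- \<gamma> - 1)) * (t - 0)"
      proof (rule norm_increment_le)
        fix s assume s: "s \<in> {0..t}"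
        have "(w has_vector_derivative angle_field g s (u \<rho> s) -
            (g (of_real \<rho>) + A * \<gamma> * \<rho> powr (- \<gamma> - 1) * cos s) *\<^sub>R (\<i> * cis s)) (at s)"
          unfolding w_def by (intro has_vector_derivative_diff u_deriv model_deriv)
        then show "(w has_vector_derivative
            (g (u \<rho> s) - g (of_real \<rho>) - A * \<gamma> * \<rho> powr (- \<gamma> - 1) * cos s) *\<^sub>R (\<i> * cis s)) (at s)"
          by (simp add: angle_field_def algebra_simps)
        show "norm ((g (u \<rho> s) - g (of_real \<rho>) - A * \<gamma> * \<rho> powr (- \<gamma> - 1) * cos s) *\<^sub>R (\<i> * cis s))
            \<le> \<delta> / 8 * \<rho> powr (- \<gamma> - 1)"
          using elim s t by (simp add: norm_mult)
      qed (use t in auto)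
      also have "\<dots> \<le> (\<delta> / 8 * \<rho> powr (- \<gamma> - 1)) * 8"
        using t \<open>\<delta> > 0\<close> by (intro mult_left_mono) auto
      finally show "norm (u \<rho> t - model \<rho> t) \<le> \<delta> * \<rho> powr (- \<gamma> - 1)"
        by (simp add: w_def u_0 model_0)
    qed
  qed
qed

text \<open>Near \<open>t = pi\<close> the sine is small, so the constant shift of \<open>g\<close>
  merely perturbs the coefficient \<rho>, while \<open>t * cos t / 2\<close> leaves the drift
  \<open>- pi / 2\<close>.\<close>

lemma Im_model:
  "Im (cis (- t) * model \<rho> t) = - (\<rho> - (g (of_real \<rho>) - 1)) * sin t +
     A * \<gamma> * \<rho> powr (- \<gamma> - 1) * (sin t + t * cos t) / 2"
proof -
  define K M where "K = g (of_real \<rho>) - 1" and "M = A * \<gamma> * \<rho> powr (- \<gamma> - 1)"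
  have eq: "cis (- t) * model \<rho> t = of_real \<rho> * cis (- t) + 1 + of_real K * (1 - cis (- t)) +
     of_real M * (cis t / 4 + \<i> * of_real t * cis (- t) / 2 - cis (- t) / 4)"
    unfolding model_def K_def[symmetric] M_def[symmetric]
    by (simp add: algebra_simps cis_mult del: cis_inverse)
  show ?thesis
    unfolding eq K_def[symmetric] M_def[symmetric] by (simp add: algebra_simps)
qed

text \<open>\<open>Im (cis (- \<tau>) * u \<rho> \<tau>)\<close> vanishes when the curve crosses the line at angle \<open>\<tau>\<close> normally.
  With \<open>\<tau> = \<pi> / (1 - \<epsilon>)\<close> and \<open>\<epsilon> = c \<rho>\<^sup>-\<^sup>\<gamma>\<^sup>-\<^sup>2\<close> its sign is decided by the sign of \<open>c - A \<gamma> / 2\<close>.\<close>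

lemma defect_tendsto:
  assumes "c \<noteq> 0"
  shows "((\<lambda>\<rho>. \<rho> powr (\<gamma> + 1) *
      Im (cis (- (pi / (1 - c * \<rho> powr (- \<gamma> - 2)))) * u \<rho> (pi / (1 - c * \<rho> powr (- \<gamma> - 2)))))
      \<longlongrightarrow> c * pi - A * \<gamma> * pi / 2) at_top"
proof -
  define e \<tau> where "e \<rho> = c * \<rho> powr (- \<gamma> - 2)" and "\<tau> \<rho> = pi / (1 - e \<rho>)" for \<rho> :: real
  have e0: "(e \<longlongrightarrow> 0) at_top"
    unfolding e_def using \<gamma> by (intro tendsto_mult_right_zero tendsto_neg_powr filterlim_ident) auto
  have "\<forall>\<^sub>F \<rho> in at_top. e \<rho> \<noteq> 0"
    using eventually_gt_at_top[of 0] by eventually_elim (use \<open>c \<noteq> 0\<close> in \<open>simp add: e_def\<close>)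
  with e0 have e_at: "filterlim e (at 0) at_top"
    by (simp add: filterlim_at)
  have \<tau>: "(\<tau> \<longlongrightarrow> pi) at_top"
    unfolding \<tau>_def using tendsto_divide[OF tendsto_const[of pi] tendsto_diff[OF tendsto_const[of 1] e0]] by simp
  \<comment> \<open>Boundedness of \<open>g\<close> suffices here, because its deviation from 1
    competes with \<rho>.\<close>
  have K: "((\<lambda>\<rho>. 1 - (g (of_real \<rho>) - 1) / \<rho>) \<longlongrightarrow> 1) at_top"
  proof -
    have "((\<lambda>\<rho>. (g (of_real \<rho>) - 1) / \<rho>) \<longlongrightarrow> 0) at_top"
    proof (rule Lim_null_comparison)
      show "\<forall>\<^sub>F \<rho> in at_top. norm ((g (of_real \<rho>) - 1) / \<rho>) \<le> inverse \<rho>"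
        using eventually_gt_at_top[of 0]
      proof eventually_elim
        case (elim \<rho>)
        have "\<bar>g (of_real \<rho>) - 1\<bar> \<le> 1"
          using g_pos[of "of_real \<rho>"] g_le[of "of_real \<rho>"] by linarith
        then show ?case using elim by (simp add: divide_right_mono inverse_eq_divide)
      qed
      show "(inverse \<longlongrightarrow> (0::real)) at_top"
        by (rule tendsto_inverse_0_at_top[OF filterlim_ident])
    qed
    then show ?thesis using tendsto_diff[OF tendsto_const[of 1]] by fastforce
  qed
  \<comment> \<open>A difference quotient at 0 evaluated along \<open>e\<close>, which therefore
    must avoid 0; this is where \<open>c\<close> being nonzero enters.\<close>
  have S: "((\<lambda>\<rho>. - sin (\<tau> \<rho>) / e \<rho>) \<longlongrightarrow> pi) at_top"
  proof -
    have "((\<lambda>x. - sin (pi / (1 - x))) has_real_derivative pi) (at 0)"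
      by (auto intro!: derivative_eq_intros)
    then have "((\<lambda>x. - sin (pi / (1 - x)) / x) \<longlongrightarrow> pi) (at 0)"
      by (simp add: has_field_derivative_iff)
    from filterlim_compose[OF this e_at] show ?thesis by (simp add: \<tau>_def)
  qed
  have "((\<lambda>\<rho>. (1 - (g (of_real \<rho>) - 1) / \<rho>) * (c * (- sin (\<tau> \<rho>) / e \<rho>)) +
      A * \<gamma> * (sin (\<tau> \<rho>) + \<tau> \<rho> * cos (\<tau> \<rho>)) / 2) \<longlongrightarrow> 1 * (c * pi) + A * \<gamma> * (sin pi + pi * cos pi) / 2) at_top"
    by (intro tendsto_intros K S \<tau>) simp
  then have main: "((\<lambda>\<rho>. (1 - (g (of_real \<rho>) - 1) / \<rho>) * (c * (- sin (\<tau> \<rho>) / e \<rho>)) +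
      A * \<gamma> * (sin (\<tau> \<rho>) + \<tau> \<rho> * cos (\<tau> \<rho>)) / 2) \<longlongrightarrow> c * pi - A * \<gamma> * pi / 2) at_top"
    by simp
  have model: "((\<lambda>\<rho>. \<rho> powr (\<gamma> + 1) * Im (cis (- \<tau> \<rho>) * model \<rho> (\<tau> \<rho>))) \<longlongrightarrow>
      c * pi - A * \<gamma> * pi / 2) at_top"
  proof (rule Lim_transform_eventually[OF main])
    show "\<forall>\<^sub>F \<rho> in at_top. (1 - (g (of_real \<rho>) - 1) / \<rho>) * (c * (- sin (\<tau> \<rho>) / e \<rho>)) +
      A * \<gamma> * (sin (\<tau> \<rho>) + \<tau> \<rho> * cos (\<tau> \<rho>)) / 2 =
      \<rho> powr (\<gamma> + 1) * Im (cis (- \<tau> \<rho>) * model \<rho> (\<tau> \<rho>))"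
      using eventually_gt_at_top[of 0]
    proof eventually_elim
      \<comment> \<open>With \<open>e \<rho> = c / (q * \<rho>)\<close>, the scaled main term
        \<open>q * \<rho> * sin (\<tau> \<rho>)\<close> equals
        \<open>c * sin (\<tau> \<rho>) / e \<rho>\<close>: the chosen power of \<rho> gives both
        competing terms order one.\<close>
      case (elim \<rho>)
      define q where "q = \<rho> powr (\<gamma> + 1)"
      have "q > 0" using elim by (simp add: q_def)
      have q: "\<rho> powr (- \<gamma> - 1) = 1 / q"
        unfolding q_def by (simp add: powr_minus_divide[symmetric])
      have "q * \<rho> = \<rho> powr (\<gamma> + 2)"
        using elim powr_add[of \<rho> "\<gamma> + 1" 1] by (simp add: q_def add.commute[of 2])
      moreover have "\<rho> powr (- \<gamma> - 2) = 1 / \<rho> powr (\<gamma> + 2)"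
        using powr_minus_divide[of \<rho> "\<gamma> + 2"] by simp
      ultimately have e: "e \<rho> = c / (q * \<rho>)" by (simp add: e_def)
      show ?case
        unfolding Im_model q e q_def[symmetric] using elim \<open>q > 0\<close> \<open>c \<noteq> 0\<close> by (simp add: field_simps)
    qed
  qed
  have "((\<lambda>\<rho>. \<rho> powr (\<gamma> + 1) * Im (cis (- \<tau> \<rho>) * (u \<rho> (\<tau> \<rho>) - model \<rho> (\<tau> \<rho>)))) \<longlongrightarrow> 0) at_top"
  proof (rule tendstoI)
    fix \<delta> :: real assume "\<delta> > 0"
    then have "\<delta> / 2 > 0" by simp
    have "\<forall>\<^sub>F \<rho> in at_top. \<tau> \<rho> > 0" "\<forall>\<^sub>F \<rho> in at_top. \<tau> \<rho> < 8"
      using order_tendstoD[OF \<tau>] pi_gt_zero pi_less_4 by auto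
    with u_model[OF \<open>\<delta> / 2 > 0\<close>]
    show "\<forall>\<^sub>F \<rho> in at_top. dist (\<rho> powr (\<gamma> + 1) * Im (cis (- \<tau> \<rho>) * (u \<rho> (\<tau> \<rho>) - model \<rho> (\<tau> \<rho>)))) 0 < \<delta>"
      using eventually_gt_at_top[of 0]
    proof eventually_elim
      case (elim \<rho>)
      have "\<bar>Im (cis (- \<tau> \<rho>) * (u \<rho> (\<tau> \<rho>) - model \<rho> (\<tau> \<rho>)))\<bar> \<le> norm (u \<rho> (\<tau> \<rho>) - model \<rho> (\<tau> \<rho>))"
        by (rule order_trans[OF abs_Im_le_cmod]) (simp add: norm_mult)
      also have "\<dots> \<le> \<delta> / 2 * \<rho> powr (- \<gamma> - 1)" using elim by auto
      finally have "\<rho> powr (\<gamma> + 1) * \<bar>Im (cis (- \<tau> \<rho>) * (u \<rho> (\<tau> \<rho>) - model \<rho> (\<tau> \<rho>)))\<bar>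
          \<le> \<rho> powr (\<gamma> + 1) * (\<delta> / 2 * \<rho> powr (- \<gamma> - 1))"
        by (intro mult_left_mono) auto
      also have "\<dots> = \<delta> / 2 * (\<rho> powr (\<gamma> + 1) * \<rho> powr (- \<gamma> - 1))" by simp
      also have "\<rho> powr (\<gamma> + 1) * \<rho> powr (- \<gamma> - 1) = 1"
        using elim by (simp add: powr_add[symmetric])
      finally show ?case using \<open>\<delta> > 0\<close> by (simp add: abs_mult)
    qed
  qed
  from tendsto_add[OF model this] show ?thesis
    by (simp add: \<tau>_def e_def algebra_simps)
qed

lemma defect_continuous:
  "continuous_on S (\<lambda>\<rho>. Im (cis (- \<tau>) * u \<rho> \<tau>))"
  using continuous_on_subset[OF u_continuous subset_UNIV] by (intro continuous_intros)

text \<open>For fixed \<epsilon> the crossing time does not depend on \<rho>, so the defect is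
  continuous in \<rho> and a sign change suffices. \<open>R\<close> is quantified after the two
  constants: \<rho> can be forced arbitrarily far out by shrinking \<epsilon> alone.\<close>

lemma normal_crossing:
  assumes "A \<noteq> 0"
  obtains a\<^sub>1 a\<^sub>2 where "a\<^sub>1 > 0" "a\<^sub>2 > 0"
    and "\<And>R. \<exists>\<epsilon>\<^sub>0>0. \<forall>\<epsilon>. A * \<epsilon> > 0 \<and> \<bar>\<epsilon>\<bar> < \<epsilon>\<^sub>0 \<longrightarrow>
      (\<exists>\<rho>. a\<^sub>1 * \<bar>\<epsilon>\<bar> powr (- 1 / (\<gamma> + 2)) \<le> \<rho> \<and> \<rho> \<le> a\<^sub>2 * \<bar>\<epsilon>\<bar> powr (- 1 / (\<gamma> + 2)) \<and> R \<le> \<rho> \<and>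
        Im (cis (- (pi / (1 - \<epsilon>))) * u \<rho> (pi / (1 - \<epsilon>))) = 0)"
proof -
  \<comment> \<open>Two values on either side of the critical
    \<open>\<bar>A\<bar> * \<gamma> / 2\<close>; the sign \<open>s\<close> below merges the cases of
    positive and negative \<open>A\<close>.\<close>
  define \<kappa>\<^sub>1 \<kappa>\<^sub>2 where "\<kappa>\<^sub>1 = \<bar>A\<bar> * \<gamma> / 4" and "\<kappa>\<^sub>2 = \<bar>A\<bar> * \<gamma>"
  have \<kappa>: "0 < \<kappa>\<^sub>1" "\<kappa>\<^sub>1 < \<kappa>\<^sub>2" using \<open>A \<noteq> 0\<close> \<gamma> by (auto simp: \<kappa>\<^sub>1_def \<kappa>\<^sub>2_def)
  define s where "s = sgn A"
  have s: "s * s = 1" "s \<noteq> 0" "s * A = \<bar>A\<bar>" using \<open>A \<noteq> 0\<close> by (auto simp: s_def sgn_if)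
  define D where "D \<epsilon> \<rho> = s * Im (cis (- (pi / (1 - \<epsilon>))) * u \<rho> (pi / (1 - \<epsilon>)))" for \<epsilon> \<rho>
  have lim: "((\<lambda>\<rho>. \<rho> powr (\<gamma> + 1) * D (s * \<kappa> * \<rho> powr (- \<gamma> - 2)) \<rho>) \<longlongrightarrow> (\<kappa> - \<bar>A\<bar> * \<gamma> / 2) * pi) at_top"
    if "\<kappa> > 0" for \<kappa>
  proof -
    have "s * \<kappa> \<noteq> 0" using that s by simp
    from tendsto_mult_left[OF defect_tendsto[OF this], of s]
    have "((\<lambda>\<rho>. \<rho> powr (\<gamma> + 1) * D (s * \<kappa> * \<rho> powr (- \<gamma> - 2)) \<rho>) \<longlongrightarrow>
        s * (s * \<kappa> * pi - A * \<gamma> * pi / 2)) at_top"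
      by (simp add: D_def mult_ac)
    also have "s * (s * \<kappa> * pi - A * \<gamma> * pi / 2) = (s * s) * \<kappa> * pi - (s * A) * \<gamma> * pi / 2"
      by (simp add: algebra_simps)
    also have "\<dots> = (\<kappa> - \<bar>A\<bar> * \<gamma> / 2) * pi" unfolding s by (simp add: algebra_simps)
    finally show ?thesis .
  qed
  have "\<forall>\<^sub>F \<rho> in at_top. \<rho> powr (\<gamma> + 1) * D (s * \<kappa>\<^sub>1 * \<rho> powr (- \<gamma> - 2)) \<rho> < 0"
    using \<open>A \<noteq> 0\<close> \<gamma> \<kappa> by (intro order_tendstoD(2)[OF lim]) (auto simp: \<kappa>\<^sub>1_def mult_less_0_iff)
  moreover have "\<forall>\<^sub>F \<rho> in at_top. \<rho> powr (\<gamma> + 1) * D (s * \<kappa>\<^sub>2 * \<rho> powr (- \<gamma> - 2)) \<rho> > 0"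
    using \<open>A \<noteq> 0\<close> \<gamma> \<kappa> by (intro order_tendstoD(1)[OF lim]) (auto simp: \<kappa>\<^sub>2_def)
  ultimately have "\<forall>\<^sub>F \<rho> in at_top. D (s * \<kappa>\<^sub>1 * \<rho> powr (- \<gamma> - 2)) \<rho> < 0 \<and>
      D (s * \<kappa>\<^sub>2 * \<rho> powr (- \<gamma> - 2)) \<rho> > 0"
    using eventually_gt_at_top[of 0]
    by eventually_elim (auto simp: mult_less_0_iff zero_less_mult_iff)
  then obtain R\<^sub>0 where R\<^sub>0: "\<And>\<rho>. \<rho> \<ge> R\<^sub>0 \<Longrightarrow> D (s * \<kappa>\<^sub>1 * \<rho> powr (- \<gamma> - 2)) \<rho> < 0"
      "\<And>\<rho>. \<rho> \<ge> R\<^sub>0 \<Longrightarrow> D (s * \<kappa>\<^sub>2 * \<rho> powr (- \<gamma> - 2)) \<rho> > 0"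
    by (auto simp: eventually_at_top_linorder)
  define a where "a \<kappa> = \<kappa> powr (1 / (\<gamma> + 2))" for \<kappa> :: real
  have exponents: "1 / (\<gamma> + 2) * - (\<gamma> + 2) = - 1" "- 1 / (\<gamma> + 2) * - (\<gamma> + 2) = 1"
    and exponents': "- (\<gamma> + 2) * (- 1 / (\<gamma> + 2)) = 1"
    using \<gamma> by (auto simp: divide_simps)
  show thesis
  proof
    show "a \<kappa>\<^sub>1 > 0" "a \<kappa>\<^sub>2 > 0" using \<kappa> by (auto simp: a_def)
    fix R
    define R' where "R' = max 1 (max R R\<^sub>0)"
    \<comment> \<open>The parameter whose inner radius is exactly \<open>R'\<close>; a smaller
      parameter has a larger inner radius.\<close>
    define \<epsilon>\<^sub>0 where "\<epsilon>\<^sub>0 = \<kappa>\<^sub>1 * R' powr (- (\<gamma> + 2))"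
    have "R' \<ge> 1" by (simp add: R'_def)
    show "\<exists>\<epsilon>\<^sub>0>0. \<forall>\<epsilon>. A * \<epsilon> > 0 \<and> \<bar>\<epsilon>\<bar> < \<epsilon>\<^sub>0 \<longrightarrow>
      (\<exists>\<rho>. a \<kappa>\<^sub>1 * \<bar>\<epsilon>\<bar> powr (- 1 / (\<gamma> + 2)) \<le> \<rho> \<and> \<rho> \<le> a \<kappa>\<^sub>2 * \<bar>\<epsilon>\<bar> powr (- 1 / (\<gamma> + 2)) \<and> R \<le> \<rho> \<and>
        Im (cis (- (pi / (1 - \<epsilon>))) * u \<rho> (pi / (1 - \<epsilon>))) = 0)"
    proof (rule exI[of _ \<epsilon>\<^sub>0], intro conjI allI impI)
      show "\<epsilon>\<^sub>0 > 0" using \<kappa> \<open>R' \<ge> 1\<close> by (simp add: \<epsilon>\<^sub>0_def)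
      fix \<epsilon> assume \<epsilon>: "A * \<epsilon> > 0 \<and> \<bar>\<epsilon>\<bar> < \<epsilon>\<^sub>0"
      then have "\<epsilon> \<noteq> 0" by auto
      have "s * \<bar>\<epsilon>\<bar> = \<epsilon>" using \<epsilon> by (auto simp: s_def sgn_if zero_less_mult_iff)
      \<comment> \<open>The solution of
        \<open>\<kappa> * r powr (- \<gamma> - 2) = \<bar>\<epsilon>\<bar>\<close>, so that the
        asymptotic signs, stated with \<epsilon> depending on \<rho>, apply to a fixed \<epsilon> at
        the two ends.\<close>
      define r where "r \<kappa> = a \<kappa> * \<bar>\<epsilon>\<bar> powr (- 1 / (\<gamma> + 2))" for \<kappa>
      have r: "r \<kappa> > 0" "s * \<kappa> * r \<kappa> powr (- \<gamma> - 2) = \<epsilon>" if "\<kappa> > 0" for \<kappa>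
      proof -
        show "r \<kappa> > 0" using that \<open>\<epsilon> \<noteq> 0\<close> by (simp add: r_def a_def)
        have "r \<kappa> powr (- (\<gamma> + 2)) = a \<kappa> powr (- (\<gamma> + 2)) * (\<bar>\<epsilon>\<bar> powr (- 1 / (\<gamma> + 2))) powr (- (\<gamma> + 2))"
          unfolding r_def by (rule powr_mult)
        also have "a \<kappa> powr (- (\<gamma> + 2)) = \<kappa> powr (- 1)"
          unfolding a_def powr_powr exponents ..
        also have "(\<bar>\<epsilon>\<bar> powr (- 1 / (\<gamma> + 2))) powr (- (\<gamma> + 2)) = \<bar>\<epsilon>\<bar> powr 1"
          unfolding powr_powr exponents ..
        also have "\<kappa> powr (- 1) * \<bar>\<epsilon>\<bar> powr 1 = \<bar>\<epsilon>\<bar> / \<kappa>"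
          using that \<open>\<epsilon> \<noteq> 0\<close> by (simp add: powr_minus_divide)
        finally have "s * \<kappa> * r \<kappa> powr (- (\<gamma> + 2)) = s * \<bar>\<epsilon>\<bar>" using that by simp
        then show "s * \<kappa> * r \<kappa> powr (- \<gamma> - 2) = \<epsilon>" using \<open>s * \<bar>\<epsilon>\<bar> = \<epsilon>\<close> by simp
      qed
      have "r \<kappa>\<^sub>1 \<le> r \<kappa>\<^sub>2"
        unfolding r_def a_def using \<kappa> \<gamma> by (intro mult_right_mono powr_mono2) auto
      have "R' \<le> r \<kappa>\<^sub>1"
      proof -
        have "\<bar>\<epsilon>\<bar> powr (- 1 / (\<gamma> + 2)) \<ge> \<epsilon>\<^sub>0 powr (- 1 / (\<gamma> + 2))"
          using \<epsilon> \<open>\<epsilon> \<noteq> 0\<close> \<gamma> by (intro powr_mono2') auto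
        moreover have "\<epsilon>\<^sub>0 powr (- 1 / (\<gamma> + 2)) = \<kappa>\<^sub>1 powr (- 1 / (\<gamma> + 2)) * R'"
        proof -
          have "\<epsilon>\<^sub>0 powr (- 1 / (\<gamma> + 2)) = \<kappa>\<^sub>1 powr (- 1 / (\<gamma> + 2)) * (R' powr (- (\<gamma> + 2))) powr (- 1 / (\<gamma> + 2))"
            unfolding \<epsilon>\<^sub>0_def by (rule powr_mult)
          also have "(R' powr (- (\<gamma> + 2))) powr (- 1 / (\<gamma> + 2)) = R' powr 1"
            unfolding powr_powr exponents' ..
          finally show ?thesis using \<open>R' \<ge> 1\<close> by simp
        qed
        ultimately have "r \<kappa>\<^sub>1 \<ge> a \<kappa>\<^sub>1 * (\<kappa>\<^sub>1 powr (- 1 / (\<gamma> + 2)) * R')"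
          unfolding r_def by (intro mult_left_mono) (auto simp: a_def)
        moreover have "a \<kappa>\<^sub>1 * \<kappa>\<^sub>1 powr (- 1 / (\<gamma> + 2)) = 1"
          using \<kappa> by (simp add: a_def powr_add[symmetric])
        ultimately show ?thesis by (simp add: mult.assoc[symmetric])
      qed
      have "D \<epsilon> (r \<kappa>\<^sub>1) < 0"
        using R\<^sub>0(1)[of "r \<kappa>\<^sub>1"] r(2)[of \<kappa>\<^sub>1] \<kappa> \<open>R' \<le> r \<kappa>\<^sub>1\<close> by (simp add: R'_def)
      moreover have "D \<epsilon> (r \<kappa>\<^sub>2) > 0"
        using R\<^sub>0(2)[of "r \<kappa>\<^sub>2"] r(2)[of \<kappa>\<^sub>2] \<kappa> \<open>R' \<le> r \<kappa>\<^sub>1\<close> \<open>r \<kappa>\<^sub>1 \<le> r \<kappa>\<^sub>2\<close> by (simp add: R'_def)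
      moreover have "continuous_on {r \<kappa>\<^sub>1..r \<kappa>\<^sub>2} (D \<epsilon>)"
        unfolding D_def by (intro continuous_on_mult_left defect_continuous)
      ultimately obtain \<rho> where \<rho>: "r \<kappa>\<^sub>1 \<le> \<rho>" "\<rho> \<le> r \<kappa>\<^sub>2" "D \<epsilon> \<rho> = 0"
        using IVT'[of "D \<epsilon>" "r \<kappa>\<^sub>1" 0 "r \<kappa>\<^sub>2"] \<open>r \<kappa>\<^sub>1 \<le> r \<kappa>\<^sub>2\<close> by auto
      then show "\<exists>\<rho>. a \<kappa>\<^sub>1 * \<bar>\<epsilon>\<bar> powr (- 1 / (\<gamma> + 2)) \<le> \<rho> \<and> \<rho> \<le> a \<kappa>\<^sub>2 * \<bar>\<epsilon>\<bar> powr (- 1 / (\<gamma> + 2)) \<and> R \<le> \<rho> \<and>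
        Im (cis (- (pi / (1 - \<epsilon>))) * u \<rho> (pi / (1 - \<epsilon>))) = 0"
        using \<open>R' \<le> r \<kappa>\<^sub>1\<close> s by (intro exI[of _ \<rho>]) (auto simp: r_def R'_def D_def)
    qed
  qed
qed

end

section \<open>Rotational symmetry and the distance to the reference curve\<close>

lemma range_rotation_eq:
  fixes w :: "real \<Rightarrow> complex"
  assumes "\<And>t. w (t + T) = cis \<theta> * w t"
  shows "curve_rotation_invariant \<theta> w"
  unfolding curve_rotation_invariant_def
proof (intro equalityI subsetI)
  fix z assume "z \<in> (\<lambda>z. exp (\<i> * of_real \<theta>) * z) ` range w"
  then obtain t where "z = exp (\<i> * of_real \<theta>) * w t" by auto
  then have "z = w (t + T)" by (simp add: assms cis_conv_exp)
  then show "z \<in> range w" by simp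
next
  fix z assume "z \<in> range w"
  then obtain t where "z = w t" by auto
  then have "z = exp (\<i> * of_real \<theta>) * w (t - T)"
    using assms[of "t - T"] by (simp add: cis_conv_exp)
  then show "z \<in> (\<lambda>z. exp (\<i> * of_real \<theta>) * z) ` range w" by blast
qed

text \<open>The time shift and the rotation angle are the same number. If \<open>r = m / n\<close>,
  then \<open>m\<close> shifts rotate by \<open>n\<close> full turns.\<close>

lemma closed_curve_rational_rotation:
  fixes w :: "real \<Rightarrow> complex"
  assumes "\<And>t. w (t + 2 * pi / r) = cis (2 * pi / r) * w t" and "r \<in> \<rat>" "r > 0"
  shows "closed_curve w"
proof -
  define T where "T = 2 * pi / r"
  have iter: "w (t + real k * T) = cis (real k * T) * w t" for k t
  proof (induction k)
    case (Suc k)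
    have "w (t + real (Suc k) * T) = w ((t + real k * T) + T)" by (simp add: algebra_simps)
    also have "\<dots> = cis T * (cis (real k * T) * w t)"
      using assms(1) Suc by (simp add: T_def)
    also have "\<dots> = cis (real (Suc k) * T) * w t"
      unfolding mult.assoc[symmetric] cis_mult by (simp add: algebra_simps)
    finally show ?case .
  qed simp
  obtain m n where "n \<noteq> 0" and mn: "\<bar>r\<bar> = real m / real n"
    using Rats_abs_nat_div_natE[OF \<open>r \<in> \<rat>\<close>] by metis
  have "m \<noteq> 0" using mn \<open>r > 0\<close> by (intro notI) simp
  have r: "r = real m / real n" using mn \<open>r > 0\<close> by simp
  have "real m * T = 2 * pi * real n"
    using \<open>m \<noteq> 0\<close> \<open>n \<noteq> 0\<close> by (simp add: T_def r)
  then have "cis (real m * T) = 1" using cis_multiple_2pi[of "real n"] by simp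
  moreover have "real m * T > 0" using \<open>m \<noteq> 0\<close> \<open>r > 0\<close> by (simp add: T_def)
  ultimately show ?thesis
    unfolding closed_curve_def using iter[of _ m] by (metis mult_1)
qed

lemma periodic_reduce:
  fixes f :: "real \<Rightarrow> 'a"
  assumes "\<And>t. f (t + T) = f t" and "T > 0"
  obtains s where "s \<in> {0..T}" "f t = f s"
proof
  interpret periodic_fun_simple f T by standard (rule assms(1))
  show "f t = f (t - of_int \<lfloor>t / T\<rfloor> * T)" by (rule minus_of_int[symmetric])
  have "of_int \<lfloor>t / T\<rfloor> * T \<le> t"
    using of_int_floor_le[of "t / T"] unfolding pos_le_divide_eq[OF \<open>T > 0\<close>] .
  moreover have "t \<le> (of_int \<lfloor>t / T\<rfloor> + 1) * T"
    using real_of_int_floor_add_one_ge[of "t / T"] unfolding pos_divide_le_eq[OF \<open>T > 0\<close>] .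
  ultimately show "t - of_int \<lfloor>t / T\<rfloor> * T \<in> {0..T}" by (simp add: ring_distribs)
qed

text \<open>A curve parametrized by tangent angle: its speed is the reciprocal of its curvature.\<close>

locale angle_curve =
  fixes B :: "complex \<Rightarrow> real" and w :: "real \<Rightarrow> complex"
  assumes B_C1: "C1_scalar B"
    and B_lower: "\<And>t. B (w t) \<ge> 1 / 2"
    and w_deriv: "\<And>t. (w has_vector_derivative (1 / B (w t)) *\<^sub>R (\<i> * cis t)) (at t)"
begin

definition \<beta> :: "real \<Rightarrow> real" where
  "\<beta> t = 1 / B (w t)"

text \<open>The derivative of \<beta>: one factor \<beta> comes from the velocity, two from
  differentiating the reciprocal of \<open>B\<close>.\<close>

definition \<beta>' :: "real \<Rightarrow> real" where
  "\<beta>' t = - (\<beta> t ^ 3 * ((\<i> * cis t) \<bullet> gradient B (w t)))"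

lemma B_pos: "B (w t) > 0"
  using B_lower[of t] by linarith

lemma \<beta>_pos: "\<beta> t > 0" and \<beta>_le: "\<beta> t \<le> 2"
  using B_lower[of t] by (auto simp: \<beta>_def field_simps)

lemma w_has_vector_derivative: "(w has_vector_derivative \<beta> t *\<^sub>R (\<i> * cis t)) (at t)"
  using w_deriv by (simp add: \<beta>_def)

lemma w_continuous: "continuous_on S w"
  using w_deriv has_vector_derivative_continuous by (intro continuous_at_imp_continuous_on) blast

lemma \<beta>_deriv: "(\<beta> has_real_derivative \<beta>' t) (at t)"
proof -
  have B: "((\<lambda>t. B (w t)) has_real_derivative (\<beta> t *\<^sub>R (\<i> * cis t)) \<bullet> gradient B (w t)) (at t)"
    by (rule C1_scalar_compose_has_real_derivative[OF B_C1 w_has_vector_derivative])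
  show ?thesis
    unfolding \<beta>_def[abs_def]
    by (rule derivative_eq_intros B refl | use B_pos[of t] in \<open>simp add: \<beta>'_def \<beta>_def field_simps power3_eq_cube\<close>)+
qed

lemma \<beta>_continuous: "continuous_on S \<beta>"
  using \<beta>_deriv DERIV_isCont by (intro continuous_at_imp_continuous_on) blast

definition w'' :: "real \<Rightarrow> complex" where
  "w'' t = \<beta>' t *\<^sub>R (\<i> * cis t) - \<beta> t *\<^sub>R cis t"

lemma w'_has_vector_derivative:
  "((\<lambda>t. \<beta> t *\<^sub>R (\<i> * cis t)) has_vector_derivative w'' t) (at t)"
proof -
  have "((\<lambda>t. \<i> * cis t) has_vector_derivative - cis t) (at t)"
    using has_vector_derivative_mult_right[OF cis_has_vector_derivative[of 1 t], of \<i>] by simp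
  from has_vector_derivative_scaleR[OF \<beta>_deriv this] show ?thesis
    by (simp add: w''_def)
qed

lemma w''_continuous: "continuous_on S w''"
proof -
  have "continuous_on S (\<lambda>t. gradient B (w t))"
    using B_C1 continuous_on_compose2[of UNIV "gradient B" S w] w_continuous
    by (auto simp: C1_scalar_def)
  then show ?thesis
    unfolding w''_def[abs_def] \<beta>'_def[abs_def]
    by (intro continuous_intros \<beta>_continuous) simp_all
qed

text \<open>The part of the acceleration containing \<open>\<beta>'\<close> is tangential and drops
  out of the product with the normal; the rest gives the square of \<beta>, and dividing by its cube
  leaves \<open>B\<close>.\<close>

lemma curvature_solution: "curvature_solution B w"
  unfolding curvature_solution_def vd_eqI[OF w_has_vector_derivative] vd_eqI[OF w'_has_vector_derivative]
proof (intro conjI allI)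
  show "C2_curve w"
    by (rule C2_curveI[OF w_has_vector_derivative w'_has_vector_derivative w''_continuous])
  fix t
  show "\<beta> t *\<^sub>R (\<i> * cis t) \<noteq> 0" using \<beta>_pos[of t] by simp
  have n: "norm (\<beta> t *\<^sub>R (\<i> * cis t)) = \<beta> t" using \<beta>_pos[of t] by (simp add: norm_mult)
  have trig: "cos t * (cos t * x) + sin t * (sin t * x) = x" for x
    by (simp add: mult.assoc[symmetric] distrib_right[symmetric])
  have "(\<i> * \<beta> t *\<^sub>R (\<i> * cis t)) \<bullet> w'' t = (\<beta> t)\<^sup>2"
    by (simp add: w''_def inner_complex_def algebra_simps power2_eq_square) (rule trig)
  then show "(\<i> * \<beta> t *\<^sub>R (\<i> * cis t)) \<bullet> w'' t / norm (\<beta> t *\<^sub>R (\<i> * cis t)) ^ 3 = B (w t)"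
    unfolding n using B_pos[of t] by (simp add: \<beta>_def power2_eq_square power3_eq_cube)
qed

text \<open>Derivatives are compared pointwise, but integrating them controls the curves only for
  bounded times. Both curves turn by the same angle under the same time shift, so one period
  suffices. The coefficients are the sums 10 + 1 + 9 and 10 + 1 + 1 over the three norms, with 10
  bounding the period and 9 = 8 + 1 coming from the cube of \<beta> being at most 8.\<close>

lemma C2_norm_sub_ref_curve_le:
  assumes \<beta>: "\<And>t. \<bar>\<beta> t - 1\<bar> \<le> X" and grad: "\<And>t. norm (gradient B (w t)) \<le> X"
    and \<epsilon>: "\<bar>\<epsilon>\<bar> < 1" "\<rho> > 0" and "w 0 = of_real \<rho> + 1"
    and rot: "\<And>t. w (t + 2 * pi / (1 - \<epsilon>)) = cis (2 * pi / (1 - \<epsilon>)) * w t" and "2 * pi / (1 - \<epsilon>) \<le> 10"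
  shows "C2_norm (\<lambda>t. w t - ref_curve \<epsilon> \<rho> t) \<le> ereal (20 * X + 12 * (\<rho> * \<bar>\<epsilon>\<bar>))"
proof -
  define T where "T = 2 * pi / (1 - \<epsilon>)"
  have "T > 0" using \<epsilon> by (simp add: T_def)
  define d where "d t = w t - ref_curve \<epsilon> \<rho> t" for t
  have v: "ref_curve \<epsilon> \<rho> = (\<lambda>t. of_real \<rho> * cis (\<epsilon> * t) + cis (1 * t))"
    by (simp add: ref_curve_def cis_conv_exp fun_eq_iff)
  define d' where "d' t = (\<beta> t - 1) *\<^sub>R (\<i> * cis t) - of_real \<rho> * (\<i> * \<epsilon> * cis (\<epsilon> * t))" for t
  define d'' where "d'' t = \<beta>' t *\<^sub>R (\<i> * cis t) - (\<beta> t - 1) *\<^sub>R cis t + of_real \<rho> * (\<epsilon> * \<epsilon> * cis (\<epsilon> * t))" for t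
  have d: "(d has_vector_derivative d' t) (at t)" for t
  proof -
    have "(d has_vector_derivative \<beta> t *\<^sub>R (\<i> * cis t) -
        (of_real \<rho> * (\<i> * \<epsilon> * cis (\<epsilon> * t)) + \<i> * of_real 1 * cis (1 * t))) (at t)"
      unfolding d_def v
      by (intro has_vector_derivative_diff has_vector_derivative_add has_vector_derivative_mult_right
          cis_has_vector_derivative w_has_vector_derivative)
    then show ?thesis by (simp add: d'_def algebra_simps)
  qed
  have d'_alt: "d' = (\<lambda>t. \<beta> t *\<^sub>R (\<i> * cis t) -
      (of_real \<rho> * (\<i> * \<epsilon>) * cis (\<epsilon> * t) + \<i> * cis (1 * t)))"
    by (simp add: d'_def fun_eq_iff algebra_simps)
  have d': "(d' has_vector_derivative d'' t) (at t)" for t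
  proof -
    have "(d' has_vector_derivative w'' t -
        (of_real \<rho> * (\<i> * \<epsilon>) * (\<i> * \<epsilon> * cis (\<epsilon> * t)) + \<i> * (\<i> * of_real 1 * cis (1 * t)))) (at t)"
      unfolding d'_alt
      by (intro has_vector_derivative_diff has_vector_derivative_add has_vector_derivative_mult_right
          cis_has_vector_derivative w'_has_vector_derivative)
    then show ?thesis by (simp add: d''_def w''_def algebra_simps)
  qed
  have n': "norm (d' t) \<le> X + \<rho> * \<bar>\<epsilon>\<bar>" for t
  proof -
    have "norm (d' t) \<le> norm ((\<beta> t - 1) *\<^sub>R (\<i> * cis t)) + norm (of_real \<rho> * (\<i> * \<epsilon> * cis (\<epsilon> * t)))"
      unfolding d'_def by (rule norm_triangle_ineq4)
    then show ?thesis using \<beta>[of t] \<epsilon> by (simp add: norm_mult)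
  qed
  have n'': "norm (d'' t) \<le> 9 * X + \<rho> * \<bar>\<epsilon>\<bar>" for t
  proof -
    have "\<bar>\<beta>' t\<bar> \<le> 8 * X"
    proof -
      have "\<bar>(\<i> * cis t) \<bullet> gradient B (w t)\<bar> \<le> norm (\<i> * cis t) * norm (gradient B (w t))"
        by (rule Cauchy_Schwarz_ineq2)
      also have "\<dots> \<le> X" using grad[of t] by (simp add: norm_mult)
      finally have "\<beta> t ^ 3 * \<bar>(\<i> * cis t) \<bullet> gradient B (w t)\<bar> \<le> 2 ^ 3 * X"
        using \<beta>_pos[of t] \<beta>_le[of t] by (intro mult_mono power_mono) (auto simp: less_imp_le)
      moreover have "\<bar>\<beta>' t\<bar> = \<beta> t ^ 3 * \<bar>(\<i> * cis t) \<bullet> gradient B (w t)\<bar>"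
        using \<beta>_pos[of t] by (simp add: \<beta>'_def abs_mult)
      ultimately show ?thesis by simp
    qed
    moreover have "norm (d'' t) \<le> norm (\<beta>' t *\<^sub>R (\<i> * cis t)) + norm ((\<beta> t - 1) *\<^sub>R cis t) +
        norm (of_real \<rho> * (\<epsilon> * \<epsilon> * cis (\<epsilon> * t)))"
      unfolding d''_def by (intro order_trans[OF norm_triangle_ineq] add_mono norm_triangle_ineq4 order_refl)
    then have "norm (d'' t) \<le> \<bar>\<beta>' t\<bar> + \<bar>\<beta> t - 1\<bar> + \<rho> * (\<bar>\<epsilon>\<bar> * \<bar>\<epsilon>\<bar>)"
      using \<epsilon> by (simp add: norm_mult)
    moreover have "\<rho> * (\<bar>\<epsilon>\<bar> * \<bar>\<epsilon>\<bar>) \<le> \<rho> * (\<bar>\<epsilon>\<bar> * 1)"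
      using \<epsilon> by (intro mult_left_mono) auto
    ultimately show ?thesis using \<beta>[of t] by linarith
  qed
  have n: "norm (d t) \<le> 10 * (X + \<rho> * \<bar>\<epsilon>\<bar>)" for t
  proof -
    \<comment> \<open>The slow circle lags behind the fast one by exactly one full turn per period,
      so both are rotated by \<open>cis T\<close>.\<close>
    have "\<epsilon> * T = T - 2 * pi" using \<epsilon> by (simp add: T_def field_simps)
    then have \<epsilon>T: "\<epsilon> * (t + T) = (\<epsilon> * t + T) - 2 * pi" for t by (simp add: algebra_simps)
    have 1: "cis (\<epsilon> * (t + T)) = cis T * cis (\<epsilon> * t)" for t
      unfolding \<epsilon>T cis_mult by (simp add: cis_divide[symmetric] add.commute)
    have 2: "cis (1 * (t + T)) = cis T * cis (1 * t)" for t
      unfolding cis_mult by (simp add: add.commute)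
    have "d (t + T) = cis T * d t" for t
      unfolding d_def v 1 2 rot[folded T_def] by (simp add: algebra_simps)
    then have "norm (d (t + T)) = norm (d t)" for t by (simp add: norm_mult)
    then obtain s where s: "s \<in> {0..T}" "norm (d t) = norm (d s)"
      using periodic_reduce[of "\<lambda>t. norm (d t)" T t] \<open>T > 0\<close> by blast
    have "norm (d s - d 0) \<le> (X + \<rho> * \<bar>\<epsilon>\<bar>) * \<bar>s - 0\<bar>"
      by (rule norm_increment_abs_le[OF d n'])
    also have "\<dots> \<le> (X + \<rho> * \<bar>\<epsilon>\<bar>) * 10"
      using s assms(7) order_trans[OF norm_ge_zero n'] by (intro mult_left_mono) (auto simp: T_def)
    finally show ?thesis using s \<open>w 0 = of_real \<rho> + 1\<close> by (simp add: d_def v mult.commute)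
  qed
  have "C2_norm d \<le> ereal (10 * (X + \<rho> * \<bar>\<epsilon>\<bar>) + (X + \<rho> * \<bar>\<epsilon>\<bar>) + (9 * X + \<rho> * \<bar>\<epsilon>\<bar>))"
    by (rule C2_norm_leI[OF d d' n n' n''])
  also have "10 * (X + \<rho> * \<bar>\<epsilon>\<bar>) + (X + \<rho> * \<bar>\<epsilon>\<bar>) + (9 * X + \<rho> * \<bar>\<epsilon>\<bar>) = 20 * X + 12 * (\<rho> * \<bar>\<epsilon>\<bar>)"
    by (simp add: algebra_simps)
  finally show ?thesis by (simp add: d_def[abs_def])
qed

end

section \<open>Motion in the magnetic field\<close>

text \<open>Positivity alone gives injectivity; the uniform lower bound forces linear growth in both
  directions and so surjectivity.\<close>

lemma bij_of_derivative_ge: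
  fixes l :: "real \<Rightarrow> real"
  assumes l: "\<And>t. (l has_real_derivative l' t) (at t)" and l': "\<And>t. l' t \<ge> b" and "b > 0"
  shows "bij l"
proof (rule bijI)
  have "l x < l y" if "x < y" for x y
    using DERIV_pos_imp_increasing[OF that, of l] l l' \<open>b > 0\<close> by (meson less_le_trans)
  then show "inj l" by (metis injI linorder_neqE_linordered_idom less_irrefl)
  have incr: "b * (y - x) \<le> l y - l x" if "x \<le> y" for x y
  proof -
    have "l x - b * x \<le> l y - b * y"
      by (rule DERIV_nonneg_imp_nondecreasing[OF that])
        (use l l' in \<open>auto intro!: exI derivative_eq_intros simp: diff_ge_0_iff_ge\<close>)
    then show ?thesis by (simp add: algebra_simps)
  qed
  have "\<exists>t. l t = y" for y
  proof -
    define x where "x = \<bar>y - l 0\<bar> / b"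
    have "x \<ge> 0" "b * x = \<bar>y - l 0\<bar>" using \<open>b > 0\<close> by (auto simp: x_def)
    have "l (- x) \<le> y" "y \<le> l x"
      using incr[of "- x" 0] incr[of 0 x] \<open>x \<ge> 0\<close> \<open>b * x = \<bar>y - l 0\<bar>\<close> by auto
    moreover have "continuous_on {- x..x} l"
      using l DERIV_isCont by (intro continuous_at_imp_continuous_on) blast
    ultimately show ?thesis using IVT'[of l "- x" y x] \<open>x \<ge> 0\<close> by auto
  qed
  then show "surj l" by (metis surjI)
qed

lemma DERIV_inv:
  fixes l :: "real \<Rightarrow> real"
  assumes l: "\<And>t. (l has_real_derivative l' t) (at t)" and "l' (inv l x) \<noteq> 0" and "bij l"
  shows "(inv l has_real_derivative inverse (l' (inv l x))) (at x)"
proof (rule DERIV_inverse_function[where f = l and a = "x - 1" and b = "x + 1"])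
  have li: "l (inv l y) = y" and il: "inv l (l y) = y" for y
    using \<open>bij l\<close> by (auto simp: bij_is_surj surj_f_inv_f bij_is_inj)
  show "l (inv l y) = y" for y by (rule li)
  have "isCont (inv l) (l (inv l x))"
    by (rule isCont_inverse_function[where f = l and g = "inv l" and d = 1])
      (use l DERIV_isCont il in auto)
  then show "isCont (inv l) x" unfolding li .
qed (use assms in auto)

section \<open>The horizontal plane in space\<close>

definition plane_embedding :: "complex \<Rightarrow> real ^ 3" where
  "plane_embedding z = vector [Re z, Im z, 0]"

lemma bounded_linear_plane_embedding: "bounded_linear plane_embedding"
  unfolding linear_conv_bounded_linear[symmetric]
  by (rule linearI) (simp_all add: plane_embedding_def vec_eq_iff forall_3)

lemma horizontal_plane_embedding [simp]: "horizontal (plane_embedding z) = z"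
  by (simp add: horizontal_def plane_embedding_def)

text \<open>This reduces the Lorentz equation to the planar equation
  \<open>m * z'' = - e * B * \<i> * z'\<close>.\<close>

lemma cross3_plane_embedding:
  "cross3 (plane_embedding z) (vector [0, 0, b]) = plane_embedding (- (of_real b * \<i> * z))"
  by (simp add: cross3_def plane_embedding_def vec_eq_iff forall_3)

lemmas plane_embedding_scaleR =
  linear_cmul[OF bounded_linear.linear[OF bounded_linear_plane_embedding]]

context angle_curve
begin

text \<open>The projection moves with constant signed speed \<open>- e / m\<close>, so the time of the motion is the
  rescaled arc length.\<close>

lemma lorentz_motion:
  fixes F :: "real ^ 3 \<Rightarrow> real ^ 3"
  assumes "m > 0" "e \<noteq> 0" and F: "\<And>q. F q = vector [0, 0, B (horizontal q)]"
    and B_upper: "\<And>t. B (w t) \<le> 2"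
  shows "\<exists>q h. lorentz_solution m e F q \<and> real_diffeomorphism h \<and> (\<forall>t. horizontal (q t) = w (h t))"
proof -
  \<comment> \<open>A planar velocity \<open>c * \<i> * cis (h s)\<close> with
    \<open>h' = c * B\<close> solves the equation exactly when \<open>m * c = - e\<close>. For
    positive \<open>e\<close> the curve is therefore traversed backwards.\<close>
  define c where "c = - e / m"
  have "c \<noteq> 0" "m * c = - e" using assms by (auto simp: c_def)
  obtain l where "\<And>t. (l has_vector_derivative \<beta> t) (at t)"
    using antiderivative_exists[OF \<beta>_continuous] by blast
  then have l: "(l has_real_derivative \<beta> t) (at t)" for t
    by (simp add: has_real_derivative_iff_has_vector_derivative)
  have "\<beta> t \<ge> 1 / 2" for t
    using B_pos[of t] B_upper[of t] by (simp add: \<beta>_def field_simps)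
  then have "bij l" by (rule bij_of_derivative_ge[OF l]) simp
  define h where "h s = inv l (c * s)" for s
  have h: "(h has_real_derivative c * B (w (h s))) (at s)" for s
  proof -
    have "(inv l has_real_derivative inverse (\<beta> (h s))) (at (c * s))"
      unfolding h_def using \<beta>_pos[of "inv l (c * s)"] by (intro DERIV_inv l \<open>bij l\<close>) simp
    then have "((\<lambda>s. inv l (c * s)) has_real_derivative inverse (\<beta> (h s)) * c) (at s)"
      by (rule DERIV_chain2) (auto intro!: derivative_eq_intros)
    then show ?thesis
      by (simp add: h_def[abs_def] \<beta>_def mult.commute)
  qed
  have h_vd: "(h has_vector_derivative c * B (w (h s))) (at s)" for s
    using h by (simp add: has_real_derivative_iff_has_vector_derivative)
  have h_cont: "continuous_on UNIV h"
    using h DERIV_isCont by (intro continuous_at_imp_continuous_on) blast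
  have Bh_cont: "continuous_on UNIV (\<lambda>s. B (w (h s)))"
    by (intro continuous_on_compose2[OF C1_scalar_continuous_on[OF B_C1]]
        continuous_on_compose2[OF w_continuous h_cont]) auto
  have hl: "h (l t / c) = t" and lh: "l (h s) / c = s" for t s
    using \<open>bij l\<close> \<open>c \<noteq> 0\<close> by (simp_all add: h_def bij_is_surj surj_f_inv_f bij_is_inj)
  then have "bij h" by (intro o_bij[of "\<lambda>t. l t / c"]) (auto simp: o_def fun_eq_iff)
  have inv_h: "inv h = (\<lambda>t. l t / c)" by (rule inv_equality) (rule lh hl)+
  have "real_diffeomorphism h"
    unfolding real_diffeomorphism_def
  proof (intro conjI)
    show "h C1_differentiable_on UNIV"
      by (rule C1_differentiable_onI[OF h_vd]) (intro continuous_intros Bh_cont)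
    have "((\<lambda>t. l t / c) has_vector_derivative \<beta> t / c) (at t)" for t
      unfolding has_real_derivative_iff_has_vector_derivative[symmetric]
      by (rule DERIV_cdivide[OF l])
    then show "inv h C1_differentiable_on UNIV"
      unfolding inv_h
      by (rule C1_differentiable_onI)
        (use \<open>c \<noteq> 0\<close> in \<open>auto intro!: continuous_intros \<beta>_continuous\<close>)
  qed (rule \<open>bij h\<close>)
  \<comment> \<open>In the velocity \<open>B\<close> cancels against \<beta>, so it has constant
    modulus and the acceleration contains no gradient of \<open>B\<close>.\<close>
  define z z' z'' where "z s = w (h s)" and "z' s = of_real c * (\<i> * cis (h s))"
    and "z'' s = - (of_real (c\<^sup>2 * B (w (h s))) * cis (h s))" for s
  have z: "(z has_vector_derivative z' s) (at s)" for s
  proof -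
    have "((w \<circ> h) has_vector_derivative (c * B (w (h s))) *\<^sub>R (\<beta> (h s) *\<^sub>R (\<i> * cis (h s)))) (at s)"
      by (rule vector_diff_chain_at[OF h_vd w_has_vector_derivative])
    then show ?thesis
      using B_pos[of "h s"] by (simp add: z_def[abs_def] z'_def o_def \<beta>_def scaleR_conv_of_real)
  qed
  have z': "(z' has_vector_derivative z'' s) (at s)" for s
  proof -
    have "((cis \<circ> h) has_vector_derivative (c * B (w (h s))) *\<^sub>R (\<i> * cis (h s))) (at s)"
      using cis_has_vector_derivative[of 1 "h s"] by (intro vector_diff_chain_at[OF h_vd]) simp
    then have "((\<lambda>s. of_real c * (\<i> * cis (h s))) has_vector_derivative
        of_real c * (\<i> * ((c * B (w (h s))) *\<^sub>R (\<i> * cis (h s))))) (at s)"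
      unfolding o_def by (intro has_vector_derivative_mult_right)
    then show ?thesis
      by (simp add: z'_def[abs_def] z''_def scaleR_conv_of_real power2_eq_square mult_ac)
  qed
  have z''_cont: "continuous_on UNIV z''"
    unfolding z''_def[abs_def] by (intro continuous_intros Bh_cont h_cont)
  note P = bounded_linear.has_vector_derivative[OF bounded_linear_plane_embedding]
  define q where "q s = plane_embedding (z s)" for s
  have q: "(q has_vector_derivative plane_embedding (z' s)) (at s)" for s
    unfolding q_def by (rule P[OF z])
  have q': "((\<lambda>s. plane_embedding (z' s)) has_vector_derivative plane_embedding (z'' s)) (at s)" for s
    by (rule P[OF z'])
  have "lorentz_solution m e F q"
    unfolding lorentz_solution_def vd_eqI[OF q] vd_eqI[OF q']
  proof (intro conjI allI)
    show "C2_curve q"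
      by (rule C2_curveI[OF q q'])
        (rule continuous_on_compose2[OF linear_continuous_on[OF bounded_linear_plane_embedding, of UNIV] z''_cont], simp)
    fix s
    have "\<i> * (of_real c * (\<i> * cis (h s))) = (\<i> * \<i>) * (of_real c * cis (h s))"
      by (simp only: mult_ac)
    then have "\<i> * z' s = - (of_real c * cis (h s))"
      by (simp add: z'_def)
    then have z'_\<i>: "of_real (B (z s)) * \<i> * z' s = - (of_real (c * B (z s)) * cis (h s))"
      by (simp add: mult.assoc)
    have "m *\<^sub>R z'' s = of_real (m * c) * (- (of_real (c * B (z s)) * cis (h s)))"
      by (simp add: z''_def z_def scaleR_conv_of_real power2_eq_square mult_ac)
    also have "\<dots> = e *\<^sub>R (- (of_real (B (z s)) * \<i> * z' s))"
      unfolding \<open>m * c = - e\<close> z'_\<i> by (simp add: scaleR_conv_of_real)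
    finally show "m *\<^sub>R plane_embedding (z'' s) = e *\<^sub>R cross3 (plane_embedding (z' s)) (F (q s))"
      unfolding F q_def horizontal_plane_embedding cross3_plane_embedding
        plane_embedding_scaleR[symmetric] by (rule arg_cong)
  qed
  then show ?thesis
    using \<open>real_diffeomorphism h\<close> by (intro exI[of _ q] exI[of _ h]) (simp add: q_def z_def)
qed

end

section \<open>Choice of the constants and verification of all claims\<close>

theorem corollary1p2:
  fixes m e A A\<^sub>1 \<gamma> \<gamma>\<^sub>1 :: real
    and F :: "real ^ 3 \<Rightarrow> real ^ 3"
    and B :: "complex \<Rightarrow> real"
  assumes "m > 0" and "e \<noteq> 0"
    and "\<And>q. F q = vector [0, 0, B (horizontal q)]"
    and "C1_scalar B" and "radial B"
    and "A \<noteq> 0" and "1 < \<gamma>" and "\<gamma> < \<gamma>\<^sub>1"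
    and "(\<lambda>u. B u - (1 + A * norm u powr (- \<gamma>) + A\<^sub>1 * norm u powr (- \<gamma>\<^sub>1)))
           \<in> o[at_infinity](\<lambda>u. norm u powr (- \<gamma> - 1))"
    and "(\<lambda>u. norm (gradient B u)) \<in> O[at_infinity](\<lambda>u. norm u powr (- min (\<gamma> + 1) \<gamma>\<^sub>1))"
  shows "\<exists>\<epsilon>bar \<mu> a\<^sub>1 a\<^sub>2. \<epsilon>bar > 0 \<and> \<mu> > 0 \<and> a\<^sub>1 > 0 \<and> a\<^sub>2 > 0 \<and>
    (\<forall>\<epsilon>. (A > 0 \<and> \<epsilon> \<in> {0<..<\<epsilon>bar}) \<or> (A < 0 \<and> \<epsilon> \<in> {-\<epsilon>bar<..<0}) \<longrightarrow>
      (\<exists>\<rho> u. \<rho> > 0 \<and> curvature_solution B u \<and>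
        a\<^sub>1 * \<bar>\<epsilon>\<bar> powr (- 1 / (\<gamma> + 2)) \<le> \<rho> \<and>
        \<rho> \<le> a\<^sub>2 * \<bar>\<epsilon>\<bar> powr (- 1 / (\<gamma> + 2)) \<and>
        C2_norm (\<lambda>t. u t - ref_curve \<epsilon> \<rho> t) \<le> ereal (\<mu> * \<bar>\<epsilon>\<bar> powr (\<gamma> / (\<gamma> + 2))) \<and>
        curve_rotation_invariant (2 * pi * \<epsilon> / (1 - \<epsilon>)) u \<and>
        curve_rotation_invariant (2 * pi / (1 - \<epsilon>)) u \<and>
        (\<epsilon> \<in> \<rat> \<longrightarrow> closed_curve u) \<and>
        (\<exists>q h. lorentz_solution m e F q \<and> real_diffeomorphism h \<and>
          (\<forall>t. horizontal (q t) = u (h t)))))"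
proof -
  interpret asymptotic_field B A A\<^sub>1 \<gamma> \<gamma>\<^sub>1
    by standard (fact assms)+
  obtain L where L: "\<And>x y. \<bar>g x - g y\<bar> \<le> L * norm (x - y)"
    using g_lipschitz by blast
  have "continuous_on UNIV g"
    unfolding g_def[abs_def]
    by (intro continuous_intros C1_scalar_continuous_on C1) (auto simp: max_def)
  then have "continuous_on UNIV (\<lambda>p :: real \<times> complex. g (snd p))"
    by (rule continuous_on_compose2) (auto intro: continuous_on_snd continuous_on_id)
  then have "continuous_on UNIV (\<lambda>(t, z). angle_field g t z)"
    unfolding angle_field_def case_prod_beta by (intro continuous_intros)
  then obtain \<phi> where \<phi>: "\<And>x. \<phi> x 0 = x"
      "\<And>x t. (\<phi> x has_vector_derivative angle_field g t (\<phi> x t)) (at t)"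
      "\<And>t. continuous_on UNIV (\<lambda>x. \<phi> x t)"
    by (rule ode_flow_exists[where M = 2, OF _ _ angle_field_lipschitz[OF L]])
      (use g_pos g_le in \<open>auto simp: less_imp_le\<close>)
  define u where "u \<rho> = \<phi> (of_real \<rho> + 1)" for \<rho> :: real
  interpret angle_flow B A A\<^sub>1 \<gamma> \<gamma>\<^sub>1 u
  proof
    show "continuous_on UNIV (\<lambda>\<rho>. u \<rho> t)" for t
      unfolding u_def by (intro continuous_on_compose2[OF \<phi>(3)] continuous_intros) auto
  qed (auto simp: u_def \<phi> angle_solution_def)
  obtain a\<^sub>1 a\<^sub>2 where a: "a\<^sub>1 > 0" "a\<^sub>2 > 0"
    and crossing: "\<And>R. \<exists>\<epsilon>\<^sub>0>0. \<forall>\<epsilon>. A * \<epsilon> > 0 \<and> \<bar>\<epsilon>\<bar> < \<epsilon>\<^sub>0 \<longrightarrow>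
      (\<exists>\<rho>. a\<^sub>1 * \<bar>\<epsilon>\<bar> powr (- 1 / (\<gamma> + 2)) \<le> \<rho> \<and> \<rho> \<le> a\<^sub>2 * \<bar>\<epsilon>\<bar> powr (- 1 / (\<gamma> + 2)) \<and> R \<le> \<rho> \<and>
        Im (cis (- (pi / (1 - \<epsilon>))) * u \<rho> (pi / (1 - \<epsilon>))) = 0)"
    using normal_crossing[OF \<open>A \<noteq> 0\<close>] by blast
  obtain C where "C > 0" and C: "\<forall>\<^sub>F \<rho> in at_top. \<forall>z. norm z \<ge> \<rho> - 20 \<longrightarrow> B z \<ge> 1 / 2 \<and> g z = 1 / B z \<and>
       \<bar>B z - 1\<bar> \<le> C * \<rho> powr (- \<gamma>) \<and> \<bar>g z - 1\<bar> \<le> C * \<rho> powr (- \<gamma>) \<and>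
       norm (gradient B z) \<le> C * \<rho> powr (- \<gamma>)"
    using B_decay by blast
  have "((\<lambda>\<rho>. C * \<rho> powr (- \<gamma>)) \<longlongrightarrow> 0) at_top"
    using \<gamma> by (intro tendsto_mult_right_zero tendsto_neg_powr filterlim_ident) auto
  then have "\<forall>\<^sub>F \<rho> in at_top. C * \<rho> powr (- \<gamma>) < 1"
    by (intro order_tendstoD(2)[of _ 0]) auto
  with C have "\<forall>\<^sub>F \<rho> in at_top. C * \<rho> powr (- \<gamma>) < 1 \<and> (\<forall>z. norm z \<ge> \<rho> - 20 \<longrightarrow> B z \<ge> 1 / 2 \<and> g z = 1 / B z \<and>
       \<bar>B z - 1\<bar> \<le> C * \<rho> powr (- \<gamma>) \<and> \<bar>g z - 1\<bar> \<le> C * \<rho> powr (- \<gamma>) \<and>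
       norm (gradient B z) \<le> C * \<rho> powr (- \<gamma>))"
    by eventually_elim blast
  then obtain R where R: "\<And>\<rho>. \<rho> \<ge> R \<Longrightarrow> C * \<rho> powr (- \<gamma>) < 1"
    and far: "\<And>\<rho> z. \<rho> \<ge> R \<Longrightarrow> norm z \<ge> \<rho> - 20 \<Longrightarrow> B z \<ge> 1 / 2 \<and> g z = 1 / B z \<and>
       \<bar>B z - 1\<bar> \<le> C * \<rho> powr (- \<gamma>) \<and> \<bar>g z - 1\<bar> \<le> C * \<rho> powr (- \<gamma>) \<and>
       norm (gradient B z) \<le> C * \<rho> powr (- \<gamma>)"
    unfolding eventually_at_top_linorder by blast
  obtain \<epsilon>\<^sub>0 where "\<epsilon>\<^sub>0 > 0" and \<epsilon>\<^sub>0: "\<And>\<epsilon>. A * \<epsilon> > 0 \<Longrightarrow> \<bar>\<epsilon>\<bar> < \<epsilon>\<^sub>0 \<Longrightarrow>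
      \<exists>\<rho>. a\<^sub>1 * \<bar>\<epsilon>\<bar> powr (- 1 / (\<gamma> + 2)) \<le> \<rho> \<and> \<rho> \<le> a\<^sub>2 * \<bar>\<epsilon>\<bar> powr (- 1 / (\<gamma> + 2)) \<and> max R 1 \<le> \<rho> \<and>
        Im (cis (- (pi / (1 - \<epsilon>))) * u \<rho> (pi / (1 - \<epsilon>))) = 0"
    using crossing[of "max R 1"] by blast
  \<comment> \<open>The coefficients 20 and 12 of the norm estimate, combined with the lower bound
    on \<rho> for \<open>\<rho> powr (- \<gamma>)\<close> and the upper bound for
    \<open>\<rho> * \<bar>\<epsilon>\<bar>\<close>.\<close>
  define \<mu> where "\<mu> = 20 * (C * a\<^sub>1 powr (- \<gamma>)) + 12 * a\<^sub>2"
  have "\<mu> > 0" using \<open>C > 0\<close> a by (simp add: \<mu>_def add_nonneg_pos)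
  show ?thesis
  \<comment> \<open>The bound 1/5 keeps the period \<open>2 * pi / (1 - \<epsilon>)\<close> at most
    10.\<close>
  proof (rule exI[of _ "min \<epsilon>\<^sub>0 (1 / 5)"], rule exI[of _ \<mu>], rule exI[of _ a\<^sub>1], rule exI[of _ a\<^sub>2],
      intro conjI allI impI)
    fix \<epsilon> :: real
    assume "(A > 0 \<and> \<epsilon> \<in> {0<..<min \<epsilon>\<^sub>0 (1 / 5)}) \<or> (A < 0 \<and> \<epsilon> \<in> {-min \<epsilon>\<^sub>0 (1 / 5)<..<0})"
    then have \<epsilon>: "A * \<epsilon> > 0" "\<bar>\<epsilon>\<bar> < \<epsilon>\<^sub>0" "\<bar>\<epsilon>\<bar> < 1 / 5" "\<epsilon> \<noteq> 0"
      by (auto simp: mult_neg_neg)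
    obtain \<rho> where \<rho>: "a\<^sub>1 * \<bar>\<epsilon>\<bar> powr (- 1 / (\<gamma> + 2)) \<le> \<rho>" "\<rho> \<le> a\<^sub>2 * \<bar>\<epsilon>\<bar> powr (- 1 / (\<gamma> + 2))"
        "\<rho> \<ge> R" "\<rho> \<ge> 1"
      and cross: "Im (cis (- (pi / (1 - \<epsilon>))) * u \<rho> (pi / (1 - \<epsilon>))) = 0"
      using \<epsilon>\<^sub>0[OF \<epsilon>(1,2)] by auto
    define X where "X = C * \<rho> powr (- \<gamma>)"
    define T where "T = 2 * pi / (1 - \<epsilon>)"
    have "T > 0" using \<epsilon> by (simp add: T_def)
    have "T \<le> 10"
    proof -
      have "T \<le> 2 * pi / (4 / 5)"
        unfolding T_def using \<epsilon> by (intro divide_left_mono) auto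
      then show ?thesis using pi_less_4 by simp
    qed
    have rot: "u \<rho> (t + T) = cis T * u \<rho> t" for t
      using angle_solution_rotation[OF u_solution radial_g L _ cross, of t]
      by (simp add: u_0 T_def)
    \<comment> \<open>Periodicity of the norm extends the distance from the origin from one period
      to all times; along the whole orbit the cut-off is then inactive and \<open>g\<close> is
      \<open>1 / B\<close>.\<close>
    have "norm (u \<rho> (t + T)) = norm (u \<rho> t)" for t by (simp add: rot norm_mult)
    have "norm (u \<rho> t) \<ge> \<rho> - 20" for t
    proof -
      obtain s where "s \<in> {0..T}" "norm (u \<rho> t) = norm (u \<rho> s)"
        using periodic_reduce[of "\<lambda>t. norm (u \<rho> t)" T t] \<open>T > 0\<close>
          \<open>\<And>t. norm (u \<rho> (t + T)) = norm (u \<rho> t)\<close> by blast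
      then show ?thesis using u_norm_ge[of s \<rho>] \<open>T \<le> 10\<close> by simp
    qed
    from far[OF \<open>\<rho> \<ge> R\<close> this]
    have B: "B (u \<rho> t) \<ge> 1 / 2" "g (u \<rho> t) = 1 / B (u \<rho> t)" "\<bar>B (u \<rho> t) - 1\<bar> \<le> X"
        "\<bar>g (u \<rho> t) - 1\<bar> \<le> X" "norm (gradient B (u \<rho> t)) \<le> X" for t
      unfolding X_def by blast+
    interpret angle_curve B "u \<rho>"
      by standard (use C1 B(1) u_deriv[of \<rho>] in \<open>simp_all add: angle_field_def B(2)\<close>)
    have \<beta>: "\<bar>\<beta> t - 1\<bar> \<le> X" for t
      using B(4)[of t] unfolding B(2) \<beta>_def .
    show "\<exists>\<rho> u. \<rho> > 0 \<and> curvature_solution B u \<and>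
        a\<^sub>1 * \<bar>\<epsilon>\<bar> powr (- 1 / (\<gamma> + 2)) \<le> \<rho> \<and>
        \<rho> \<le> a\<^sub>2 * \<bar>\<epsilon>\<bar> powr (- 1 / (\<gamma> + 2)) \<and>
        C2_norm (\<lambda>t. u t - ref_curve \<epsilon> \<rho> t) \<le> ereal (\<mu> * \<bar>\<epsilon>\<bar> powr (\<gamma> / (\<gamma> + 2))) \<and>
        curve_rotation_invariant (2 * pi * \<epsilon> / (1 - \<epsilon>)) u \<and>
        curve_rotation_invariant (2 * pi / (1 - \<epsilon>)) u \<and>
        (\<epsilon> \<in> \<rat> \<longrightarrow> closed_curve u) \<and>
        (\<exists>q h. lorentz_solution m e F q \<and> real_diffeomorphism h \<and>
          (\<forall>t. horizontal (q t) = u (h t)))"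
    proof (intro exI[of _ \<rho>] exI[of _ "u \<rho>"] conjI impI)
      show "\<rho> > 0" using \<open>\<rho> \<ge> 1\<close> by simp
      show "curvature_solution B (u \<rho>)" by (rule curvature_solution)
      show "a\<^sub>1 * \<bar>\<epsilon>\<bar> powr (- 1 / (\<gamma> + 2)) \<le> \<rho>" "\<rho> \<le> a\<^sub>2 * \<bar>\<epsilon>\<bar> powr (- 1 / (\<gamma> + 2))"
        by (fact \<rho>)+
      have "C2_norm (\<lambda>t. u \<rho> t - ref_curve \<epsilon> \<rho> t) \<le> ereal (20 * X + 12 * (\<rho> * \<bar>\<epsilon>\<bar>))"
        using \<beta> B(5) \<epsilon> \<open>\<rho> > 0\<close> u_0 rot \<open>T \<le> 10\<close> unfolding T_def
        by (intro C2_norm_sub_ref_curve_le) auto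
      also have "20 * X + 12 * (\<rho> * \<bar>\<epsilon>\<bar>) \<le> \<mu> * \<bar>\<epsilon>\<bar> powr (\<gamma> / (\<gamma> + 2))"
      proof -
        define E where "E = \<bar>\<epsilon>\<bar> powr (\<gamma> / (\<gamma> + 2))"
        have "\<rho> powr (- \<gamma>) \<le> (a\<^sub>1 * \<bar>\<epsilon>\<bar> powr (- 1 / (\<gamma> + 2))) powr (- \<gamma>)"
          using a \<rho> \<gamma> \<epsilon> by (intro powr_mono2') auto
        also have "\<dots> = a\<^sub>1 powr (- \<gamma>) * (\<bar>\<epsilon>\<bar> powr (- 1 / (\<gamma> + 2))) powr (- \<gamma>)"
          by (rule powr_mult)
        also have "(\<bar>\<epsilon>\<bar> powr (- 1 / (\<gamma> + 2))) powr (- \<gamma>) = E"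
          by (simp add: E_def powr_powr)
        finally have "X \<le> C * (a\<^sub>1 powr (- \<gamma>) * E)"
          unfolding X_def using \<open>C > 0\<close> by (intro mult_left_mono) auto
        moreover have "\<rho> * \<bar>\<epsilon>\<bar> \<le> a\<^sub>2 * E"
        proof -
          have "\<rho> * \<bar>\<epsilon>\<bar> \<le> (a\<^sub>2 * \<bar>\<epsilon>\<bar> powr (- 1 / (\<gamma> + 2))) * \<bar>\<epsilon>\<bar>"
            using \<rho> by (intro mult_right_mono) auto
          also have "\<dots> = a\<^sub>2 * (\<bar>\<epsilon>\<bar> powr (- 1 / (\<gamma> + 2)) * \<bar>\<epsilon>\<bar> powr 1)"
            by simp
          also have "\<bar>\<epsilon>\<bar> powr (- 1 / (\<gamma> + 2)) * \<bar>\<epsilon>\<bar> powr 1 = \<bar>\<epsilon>\<bar> powr (- 1 / (\<gamma> + 2) + 1)"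
            by (rule powr_add[symmetric])
          \<comment> \<open>The exponent on the left is
            \<open>(\<gamma> + 1) / (\<gamma> + 2)\<close>, larger than that of \<open>E\<close>,
            and \<epsilon> is below 1 in size.\<close>
          also have "\<dots> \<le> E"
            unfolding E_def using \<epsilon> \<gamma> by (intro powr_mono') (auto simp: field_simps)
          finally show ?thesis using a by simp
        qed
        ultimately show ?thesis unfolding \<mu>_def E_def[symmetric] by (simp add: algebra_simps)
      qed
      finally show "C2_norm (\<lambda>t. u \<rho> t - ref_curve \<epsilon> \<rho> t) \<le> ereal (\<mu> * \<bar>\<epsilon>\<bar> powr (\<gamma> / (\<gamma> + 2)))"
        by simp
      show "curve_rotation_invariant (2 * pi / (1 - \<epsilon>)) (u \<rho>)"
        using rot unfolding T_def by (rule range_rotation_eq)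
      have "2 * pi * \<epsilon> / (1 - \<epsilon>) = T - 2 * pi" using \<epsilon> by (simp add: T_def field_simps)
      then have "cis (2 * pi * \<epsilon> / (1 - \<epsilon>)) = cis T" by (simp add: cis_divide[symmetric])
      then show "curve_rotation_invariant (2 * pi * \<epsilon> / (1 - \<epsilon>)) (u \<rho>)"
        using rot by (intro range_rotation_eq[of _ T]) simp
      show "closed_curve (u \<rho>)" if "\<epsilon> \<in> \<rat>"
        using rot \<epsilon> that unfolding T_def
        by (intro closed_curve_rational_rotation[of "u \<rho>" "1 - \<epsilon>"]) auto
      have "B (u \<rho> t) \<le> 2" for t
        using B(3)[of t] R[OF \<open>\<rho> \<ge> R\<close>] unfolding X_def by linarith
      then show "\<exists>q h. lorentz_solution m e F q \<and> real_diffeomorphism h \<and> (\<forall>t. horizontal (q t) = u \<rho> (h t))"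
        by (rule lorentz_motion[OF \<open>m > 0\<close> \<open>e \<noteq> 0\<close> assms(3)])
    qed
  qed (use \<open>\<epsilon>\<^sub>0 > 0\<close> \<open>\<mu> > 0\<close> a in auto)
qed

end
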